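(* Let $B\in\mathbb{R}^{d\times d}$ be a symmetric positive definite matrix, let $1\le p\le d$, and let $\mathrm{St}_B(p,d)=\{X\in\mathbb{R}^{d\times p}: X^{T}BX=I_p\}$. Let $X\mapsto M_X$ be a smooth mapping from $\mathbb{R}^{d\times p}$ to the symmetric positive definite $d\times d$ matrices, and equip $\mathbb{R}^{d\times p}$ with the Riemannian metric $\mathrm{Tr}(\xi_X^{T}M_X\eta_X)$ (for $\xi_X,\eta_X\in T_X\mathbb{R}^{d\times p}\simeq\mathbb{R}^{d\times p}$), and $\mathrm{St}_B(p,d)$ with the induced metric $g_X$. Then for every $X\in \mathrm{St}_B(p,d)$ the orthogonal projections, with respect to this inner product, of $T_X\mathbb{R}^{d\times p}\simeq\mathbb{R}^{d\times p}$ onto the normal space $(T_X\mathrm{St}_B(p,d))^{\perp}$ and onto the tangent space $T_X\mathrm{St}_B(p,d)$ (given in ambient coordinates) are, respectively, $$\Pi_X^{\perp}(\xi_X)=M_X^{-1}BXS_{\xi_X}$$ and $$\Pi_X(\xi_X)=(\mathrm{id}_{T_X\mathbb{R}^{d\times p}}-\Pi_X^{\perp})(\xi_X)=\xi_X-M_X^{-1}BXS_{\xi_X},$$ for $\xi_X\in T_X\mathbb{R}^{d\times p}$, where $S_{\xi_X}\in\mathbb{R}^{p\times p}$ is the unique solution of the Sylvester equation $$\left(X^{T}BM_X^{-1}BX\right)S_{\xi_X}+S_{\xi_X}\left(X^{T}BM_X^{-1}BX\right)=X^{T}B\xi_X+\left(X^{T}B\xi_X\right)^{T}.$$ Moreover,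 the cost of computing $\Pi_X(\xi_X)$ (in ambient coordinates) for an arbitrary $\xi_X$ is $O(T_Bp+T_{M^{-1}}p+dp^{2})$, where $T_B$ is the cost of computing the product of $B$ with a vector and $T_{M^{-1}}$ is the maximal cost, over all $X\in\mathrm{St}_B(p,d)$, of computing the product of $M_X^{-1}$ with a vector.
   Context: $\mathrm{St}_B(p,d)$ (the generalized Stiefel manifold) is viewed as an embedded submanifold of $\mathbb{R}^{d\times p}$; its tangent space at $X$ is $T_X\mathrm{St}_B(p,d)=\{Z\in\mathbb{R}^{d\times p}: Z^{T}BX+X^{T}BZ=0\}$. The normal space $(T_X\mathrm{St}_B(p,d))^{\perp}$ is the orthogonal complement of $T_X\mathrm{St}_B(p,d)$ in $\mathbb{R}^{d\times p}$ with respect to the inner product $\langle U,V\rangle_{M_X}=\mathrm{Tr}(U^{T}M_XV)$. Costs are measured in number of arithmetic operations, where the costs $T_B$ and $T_{M^{-1}}$ are possibly after preprocessing, and solving a $p\times p$ Sylvester equation is counted as $O(p^3)$ operations. *)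

theory Defs
  imports
    Complex_Main
    "HOL-Library.Landau_Symbols"
    "Jordan_Normal_Form.Matrix"
    "Jordan_Normal_Form.Gauss_Jordan_Elimination"
begin

section \<open>Matrices\<close>

definition trace_mat :: "real mat \<Rightarrow> real" where
  "trace_mat A = (\<Sum>i<dim_row A. A $$ (i, i))"

definition spd_mat :: "nat \<Rightarrow> real mat \<Rightarrow> bool" where
  "spd_mat n A \<longleftrightarrow> A \<in> carrier_mat n n \<and> transpose_mat A = A \<and>
     (\<forall>v \<in> carrier_vec n. v \<noteq> 0\<^sub>v n \<longrightarrow> v \<bullet> (A *\<^sub>v v) > 0)"

text \<open>Only used for invertible matrices, where the library's inverse is not None.\<close>

definition mat_inv :: "real mat \<Rightarrow> real mat" where
  "mat_inv A = the (mat_inverse A)"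

text \<open>The entries in row-major order.\<close>

definition entries :: "real mat \<Rightarrow> real list" where
  "entries A = concat (mat_to_list A)"

definition is_sylvester_solution ::
    "nat \<Rightarrow> real mat \<Rightarrow> real mat \<Rightarrow> real mat \<Rightarrow> real mat \<Rightarrow> bool" where
  "is_sylvester_solution n P Q F S \<longleftrightarrow> S \<in> carrier_mat n n \<and> P * S + S * Q = F"


section \<open>Smooth functions of a matrix\<close>

text \<open>The type of matrices carries no topology, since it contains matrices of all sizes.
  On the \<open>d \<times> p\<close> matrices, being of class \<open>C\<^sup>k\<close> is therefore expressed in coordinates: all partial
  derivatives of order \<open>k\<close> exist everywhere and are continuous. Values of the function at matrices
  of another size play no role.\<close>

definition continuous_on_mats :: "nat \<Rightarrow> nat \<Rightarrow> (real mat \<Rightarrow> real) \<Rightarrow> bool" where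
  "continuous_on_mats d p f \<longleftrightarrow>
     (\<forall>X \<in> carrier_mat d p. \<forall>e > 0. \<exists>\<delta> > 0. \<forall>Y \<in> carrier_mat d p.
        (\<forall>i < d. \<forall>j < p. \<bar>Y $$ (i, j) - X $$ (i, j)\<bar> < \<delta>) \<longrightarrow> \<bar>f Y - f X\<bar> < e)"

definition basis_mat :: "nat \<Rightarrow> nat \<Rightarrow> nat \<Rightarrow> nat \<Rightarrow> real mat" where
  "basis_mat d p i j = mat d p (\<lambda>(k, l). if k = i \<and> l = j then 1 else 0)"

primrec Ck_on_mats :: "nat \<Rightarrow> nat \<Rightarrow> nat \<Rightarrow> (real mat \<Rightarrow> real) \<Rightarrow> bool" where
  "Ck_on_mats d p 0 f = continuous_on_mats d p f"
| "Ck_on_mats d p (Suc k) f =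
     (\<forall>i < d. \<forall>j < p. \<exists>g.
        (\<forall>X \<in> carrier_mat d p.
           ((\<lambda>t. f (X + t \<cdot>\<^sub>m basis_mat d p i j)) has_real_derivative g X) (at 0)) \<and>
        Ck_on_mats d p k g)"

definition smooth_mat_map :: "nat \<Rightarrow> nat \<Rightarrow> nat \<Rightarrow> (real mat \<Rightarrow> real mat) \<Rightarrow> bool" where
  "smooth_mat_map d p n M \<longleftrightarrow>
     (\<forall>r < n. \<forall>s < n. \<forall>k. Ck_on_mats d p k (\<lambda>X. M X $$ (r, s)))"


section \<open>The generalized Stiefel manifold\<close>

definition stiefel :: "nat \<Rightarrow> nat \<Rightarrow> real mat \<Rightarrow> real mat set" where
  "stiefel d p B = {X \<in> carrier_mat d p. transpose_mat X * B * X = 1\<^sub>m p}"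

definition tangent_space :: "nat \<Rightarrow> nat \<Rightarrow> real mat \<Rightarrow> real mat \<Rightarrow> real mat set" where
  "tangent_space d p B X =
     {Z \<in> carrier_mat d p. transpose_mat Z * B * X + transpose_mat X * B * Z = 0\<^sub>m p p}"

definition metric :: "real mat \<Rightarrow> real mat \<Rightarrow> real mat \<Rightarrow> real" where
  "metric MX U V = trace_mat (transpose_mat U * MX * V)"

definition normal_space ::
    "nat \<Rightarrow> nat \<Rightarrow> real mat \<Rightarrow> (real mat \<Rightarrow> real mat) \<Rightarrow> real mat \<Rightarrow> real mat set" where
  "normal_space d p B M X =
     {N \<in> carrier_mat d p. \<forall>Z \<in> tangent_space d p B X. metric (M X) N Z = 0}"

definition stiefel_setting ::
    "nat \<Rightarrow> nat \<Rightarrow> real mat \<Rightarrow> (real mat \<Rightarrow> real mat) \<Rightarrow> bool" where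
  "stiefel_setting d p B M \<longleftrightarrow>
     1 \<le> p \<and> p \<le> d \<and> spd_mat d B \<and>
     (\<forall>X \<in> carrier_mat d p. spd_mat d (M X)) \<and> smooth_mat_map d p d M"

definition is_orth_proj ::
    "(real mat \<Rightarrow> real mat \<Rightarrow> real) \<Rightarrow> real mat set \<Rightarrow> real mat \<Rightarrow> real mat \<Rightarrow> bool" where
  "is_orth_proj ip V \<xi> \<eta> \<longleftrightarrow> \<eta> \<in> V \<and> (\<forall>v \<in> V. ip (\<xi> - \<eta>) v = 0)"

definition orth_proj ::
    "(real mat \<Rightarrow> real mat \<Rightarrow> real) \<Rightarrow> real mat set \<Rightarrow> real mat \<Rightarrow> real mat" where
  "orth_proj ip V \<xi> = (THE \<eta>. is_orth_proj ip V \<xi> \<eta>)"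


section \<open>Counting arithmetic operations\<close>

text \<open>Straight-line programs over the reals. The state is the list of all inputs and of all values
  computed so far; an instruction refers to these by position and appends its results. A program
  also lists the positions at which its output is found. Reading beyond the end of the state
  and division by zero are undefined: the program then has no run.\<close>

type_synonym 'i program = "'i list \<times> nat list"

definition read_at :: "real list \<Rightarrow> nat list \<Rightarrow> real list \<Rightarrow> bool" where
  "read_at s is vs \<longleftrightarrow> set is \<subseteq> {..<length s} \<and> vs = map (\<lambda>i. s ! i) is"

inductive run :: "(real list \<Rightarrow> 'i \<Rightarrow> real list \<Rightarrow> bool) \<Rightarrow> real list \<Rightarrow> 'i list \<Rightarrow> real list \<Rightarrow> bool"
  for step where
  run_Nil: "run step s [] s"
| run_Cons: "step s c vs \<Longrightarrow> run step (s @ vs) cs s' \<Longrightarrow> run step s (c # cs) s'"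

definition computes ::
    "(real list \<Rightarrow> 'i \<Rightarrow> real list \<Rightarrow> bool) \<Rightarrow> 'i program \<Rightarrow> real list \<Rightarrow> real list \<Rightarrow> bool" where
  "computes step P inp res \<longleftrightarrow> (\<exists>s. run step inp (fst P) s \<and> read_at s (snd P) res)"

datatype arith = Const real | Add nat nat | Sub nat nat | Mul nat nat | Div nat nat

inductive arith_step :: "real list \<Rightarrow> arith \<Rightarrow> real list \<Rightarrow> bool" where
  "arith_step s (Const c) [c]"
| "read_at s [i, j] [x, y] \<Longrightarrow> arith_step s (Add i j) [x + y]"
| "read_at s [i, j] [x, y] \<Longrightarrow> arith_step s (Sub i j) [x - y]"
| "read_at s [i, j] [x, y] \<Longrightarrow> arith_step s (Mul i j) [x * y]"
| "read_at s [i, j] [x, y] \<Longrightarrow> y \<noteq> 0 \<Longrightarrow> arith_step s (Div i j) [x / y]"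

fun arith_cost :: "arith \<Rightarrow> nat" where
  "arith_cost (Const c) = 0"
| "arith_cost _ = 1"

text \<open>A routine for multiplying vectors by the fixed matrix \<open>A\<close>. Its constants may depend
  on \<open>A\<close> in any way and are free of charge; this is the preprocessing.\<close>

definition matvec_routine :: "nat \<Rightarrow> real mat \<Rightarrow> arith program \<Rightarrow> bool" where
  "matvec_routine n A R \<longleftrightarrow>
     (\<forall>v \<in> carrier_vec n. computes arith_step R (list_of_vec v) (list_of_vec (A *\<^sub>v v)))"

definition routine_cost :: "arith program \<Rightarrow> nat" where
  "routine_cost R = sum_list (map arith_cost (fst R))"

text \<open>A main program may moreover call the routines for multiplying a vector by \<open>B\<close> and by
  \<open>W = M\<^sub>X\<^sup>-\<^sup>1\<close>, and solve an \<open>n \<times> n\<close> Sylvester equation that has a unique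
  solution. It has no other access to these two matrices.\<close>

datatype instr =
    Arith arith
  | Mult_B "nat list"
  | Mult_Minv "nat list"
  | Solve_Sylvester nat "nat list" "nat list" "nat list"

inductive instr_step :: "real mat \<Rightarrow> real mat \<Rightarrow> real list \<Rightarrow> instr \<Rightarrow> real list \<Rightarrow> bool"
  for B W where
  "arith_step s a vs \<Longrightarrow> instr_step B W s (Arith a) vs"
| "read_at s is (list_of_vec v) \<Longrightarrow> v \<in> carrier_vec (dim_col B) \<Longrightarrow>
     instr_step B W s (Mult_B is) (list_of_vec (B *\<^sub>v v))"
| "read_at s is (list_of_vec v) \<Longrightarrow> v \<in> carrier_vec (dim_col W) \<Longrightarrow>
     instr_step B W s (Mult_Minv is) (list_of_vec (W *\<^sub>v v))"
| "P \<in> carrier_mat n n \<Longrightarrow> Q \<in> carrier_mat n n \<Longrightarrow> F \<in> carrier_mat n n \<Longrightarrow>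
     read_at s is (entries P) \<Longrightarrow> read_at s js (entries Q) \<Longrightarrow> read_at s ks (entries F) \<Longrightarrow>
     is_sylvester_solution n P Q F S \<Longrightarrow>
     (\<And>S'. is_sylvester_solution n P Q F S' \<Longrightarrow> S' = S) \<Longrightarrow>
     instr_step B W s (Solve_Sylvester n is js ks) (entries S)"

text \<open>\<open>tB\<close>, \<open>tM\<close> and \<open>syl n\<close> are the charges for the three non-elementary instructions.\<close>

fun instr_cost :: "nat \<Rightarrow> nat \<Rightarrow> (nat \<Rightarrow> nat) \<Rightarrow> instr \<Rightarrow> nat" where
  "instr_cost tB tM syl (Arith a) = arith_cost a"
| "instr_cost tB tM syl (Mult_B is) = tB"
| "instr_cost tB tM syl (Mult_Minv is) = tM"
| "instr_cost tB tM syl (Solve_Sylvester n is js ks) = syl n"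

definition program_cost :: "nat \<Rightarrow> nat \<Rightarrow> (nat \<Rightarrow> nat) \<Rightarrow> instr program \<Rightarrow> nat" where
  "program_cost tB tM syl P = sum_list (map (instr_cost tB tM syl) (fst P))"

end

theory Submission
  imports Defs "Jordan_Normal_Form.Determinant"
begin

text \<open>
  Write \<open>W = M\<^sub>X\<^sup>-\<^sup>1\<close> and \<open>A = X\<^sup>T B W B X\<close>. On the manifold \<open>B X\<close> has the left inverse \<open>X\<^sup>T\<close>, so
  \<open>A\<close> is symmetric positive definite (\<open>spd_A\<close>). For such an \<open>A\<close> the map \<open>S \<mapsto> A S + S A\<close> has trivial
  kernel, because pairing it with \<open>S\<close> in the trace inner product gives a positive definite form; hence
  the Sylvester equation has exactly one solution (\<open>sylvester_unique_solution\<close>), and this solution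
  inherits the symmetry of the right-hand side.

  A matrix \<open>Z\<close> is tangent if and only if \<open>X\<^sup>T B Z\<close> is skew-symmetric. The pairing of \<open>W B X S\<close> with \<open>Z\<close>
  in the metric is the trace of \<open>S (X\<^sup>T B Z)\<close>, a symmetric matrix times a skew-symmetric one, so
  \<open>W B X S\<close> is normal (\<open>normal_part_in_normal_space\<close>). The Sylvester equation says
  precisely that \<open>\<xi> - W B X S\<close> is tangent (\<open>tangent_part_in_tangent_space\<close>). Thus \<open>\<xi>\<close> is split into a
  normal and a tangent part, and these are its two orthogonal projections.

  For the cost, the formula is evaluated by an explicit program: \<open>Y = B X\<close> and \<open>W Y\<close> take \<open>p\<close>
  multiplications by \<open>B\<close> and by \<open>W\<close>; the remaining work consists of three matrix products with
  \<open>d p\<^sup>2\<close> scalar multiplications each, entrywise operations, and one \<open>p \<times> p\<close> Sylvester equation, whose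
  cubic cost is of order \<open>d p\<^sup>2\<close> since \<open>p \<le> d\<close>. The correctness proof tracks at which positions of
  the state each intermediate matrix is stored (\<open>projection_prog_correct\<close>).
\<close>

section \<open>Symmetric positive definite matrices\<close>

lemma spd_matD:
  assumes "spd_mat n A"
  shows "A \<in> carrier_mat n n" "transpose_mat A = A"
    "\<And>v. v \<in> carrier_vec n \<Longrightarrow> v \<noteq> 0\<^sub>v n \<Longrightarrow> v \<bullet> (A *\<^sub>v v) > 0"
    "\<And>v. v \<in> carrier_vec n \<Longrightarrow> v \<bullet> (A *\<^sub>v v) \<ge> 0"
proof -
  show "A \<in> carrier_mat n n" "transpose_mat A = A"
    and pos: "\<And>v. v \<in> carrier_vec n \<Longrightarrow> v \<noteq> 0\<^sub>v n \<Longrightarrow> v \<bullet> (A *\<^sub>v v) > 0"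
    using assms by (auto simp: spd_mat_def)
  then show "v \<bullet> (A *\<^sub>v v) \<ge> 0" if "v \<in> carrier_vec n" for v
    using that by (cases "v = 0\<^sub>v n") (auto intro: less_imp_le)
qed

lemma transpose_mult_sym_mult:
  assumes A: "A \<in> carrier_mat n n" "transpose_mat A = A"
    and c: "U \<in> carrier_mat n m" "V \<in> carrier_mat n k"
  shows "transpose_mat (transpose_mat U * A * V) = transpose_mat V * A * (U :: real mat)"
proof -
  have "transpose_mat (transpose_mat U * A * V) = transpose_mat V * (transpose_mat A * transpose_mat (transpose_mat U))"
    using A(1) c transpose_mult[of "transpose_mat U * A" m n V k] transpose_mult[of "transpose_mat U" m n A n]
    by simp
  then show ?thesis using A c by (simp add: assoc_mult_mat[of _ k n _ n _ m])
qed

lemma mat_inv_of_injective: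
  assumes A: "A \<in> carrier_mat n n"
    and inj: "\<And>v. v \<in> carrier_vec n \<Longrightarrow> A *\<^sub>v v = 0\<^sub>v n \<Longrightarrow> v = 0\<^sub>v n"
  shows "mat_inv A \<in> carrier_mat n n" "A * mat_inv A = 1\<^sub>m n" "mat_inv A * A = 1\<^sub>m n"
proof -
  have "det A \<noteq> 0"
    using det_0_iff_vec_prod_zero_field[OF A] inj by blast
  then have "A \<in> Units (ring_mat TYPE(real) n ())"
    by (rule det_non_zero_imp_unit[OF A])
  then obtain W where "mat_inverse A = Some W"
    using mat_inverse(1)[OF A, where b = "()"] by (cases "mat_inverse A") auto
  with mat_inverse(2)[OF A this]
  show "mat_inv A \<in> carrier_mat n n" "A * mat_inv A = 1\<^sub>m n" "mat_inv A * A = 1\<^sub>m n"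
    by (auto simp: mat_inv_def)
qed

lemma spd_mat_inv:
  assumes "spd_mat n A"
  shows "mat_inv A \<in> carrier_mat n n" "A * mat_inv A = 1\<^sub>m n" "mat_inv A * A = 1\<^sub>m n"
proof -
  have "v = 0\<^sub>v n" if v: "v \<in> carrier_vec n" and "A *\<^sub>v v = 0\<^sub>v n" for v
    using spd_matD(3)[OF assms v] that by auto
  from mat_inv_of_injective[OF spd_matD(1)[OF assms] this]
  show "mat_inv A \<in> carrier_mat n n" "A * mat_inv A = 1\<^sub>m n" "mat_inv A * A = 1\<^sub>m n" by auto
qed

text \<open>Moving one factor \<open>Y\<close> across the inner product turns the form of \<open>Y\<^sup>T A Y\<close> at \<open>v\<close> into the
  form of \<open>A\<close> at \<open>Y v\<close>, and injectivity of \<open>Y\<close> keeps \<open>Y v\<close> away from zero.\<close>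

lemma spd_mat_congruence:
  assumes A: "spd_mat n A" and Y: "Y \<in> carrier_mat n m"
    and inj: "\<And>v. v \<in> carrier_vec m \<Longrightarrow> Y *\<^sub>v v = 0\<^sub>v n \<Longrightarrow> v = 0\<^sub>v m"
  shows "spd_mat m (transpose_mat Y * A * Y)"
  unfolding spd_mat_def
proof (intro conjI ballI impI)
  note Ac = spd_matD(1)[OF A]
  note c = Ac Y
  show "transpose_mat Y * A * Y \<in> carrier_mat m m" using c by auto
  show "transpose_mat (transpose_mat Y * A * Y) = transpose_mat Y * A * Y"
    by (rule transpose_mult_sym_mult[OF Ac spd_matD(2)[OF A] Y Y])
  fix v :: "real vec" assume v: "v \<in> carrier_vec m" "v \<noteq> 0\<^sub>v m"
  have Yv: "Y *\<^sub>v v \<in> carrier_vec n" using Y v by simp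
  have "v \<bullet> (transpose_mat Y * A * Y *\<^sub>v v) = v \<bullet> (transpose_mat Y *\<^sub>v (A *\<^sub>v (Y *\<^sub>v v)))"
    using c v by (simp add: assoc_mult_mat_vec[of _ m n _ m] assoc_mult_mat_vec[of _ m n _ n])
  also have "\<dots> = (transpose_mat Y *\<^sub>v (A *\<^sub>v (Y *\<^sub>v v))) \<bullet> v"
    using c v by (intro comm_scalar_prod[of _ m]) auto
  also have "\<dots> = (A *\<^sub>v (Y *\<^sub>v v)) \<bullet> (Y *\<^sub>v v)"
    using Y v Ac Yv by (intro transpose_vec_mult_scalar[of _ n m]) auto
  also have "\<dots> = (Y *\<^sub>v v) \<bullet> (A *\<^sub>v (Y *\<^sub>v v))"
    using Ac Yv by (intro comm_scalar_prod[of _ n]) auto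
  also have "\<dots> > 0" using spd_matD(3)[OF A Yv] inj[OF v(1)] v(2) by auto
  finally show "v \<bullet> (transpose_mat Y * A * Y *\<^sub>v v) > 0" .
qed

text \<open>An instance of the congruence principle: \<open>W = A\<^sup>-\<^sup>1\<close> satisfies \<open>W\<^sup>T A W = W\<close> and is injective.\<close>

lemma spd_mat_inv_spd:
  assumes A: "spd_mat n A"
  shows "spd_mat n (mat_inv A)"
proof -
  define W where "W = mat_inv A"
  note c = spd_matD(1)[OF A]
  note W = spd_mat_inv[OF A, folded W_def]
  have "transpose_mat W * A = transpose_mat (A * W)"
    using c W(1) by (simp add: transpose_mult[of _ n n] spd_matD(2)[OF A])
  then have WA: "transpose_mat W * A = 1\<^sub>m n" using W by simp
  have inj: "v = 0\<^sub>v n" if v: "v \<in> carrier_vec n" and "W *\<^sub>v v = 0\<^sub>v n" for v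
  proof -
    have "v = (A * W) *\<^sub>v v" using v W by simp
    also have "\<dots> = A *\<^sub>v (W *\<^sub>v v)" using v c W(1) by (simp add: assoc_mult_mat_vec[of _ n n _ n])
    finally show ?thesis using that c by auto
  qed
  have "transpose_mat W * A * W = W" using WA W(1) by simp
  with spd_mat_congruence[OF A W(1) inj] show ?thesis by (simp add: W_def)
qed


section \<open>Traces\<close>

lemma trace_mat_transpose_mult:
  assumes "U \<in> carrier_mat n m" "V \<in> carrier_mat n m"
  shows "trace_mat (transpose_mat U * V) = (\<Sum>j<m. col U j \<bullet> col V j)"
  using assms by (auto simp: trace_mat_def intro!: sum.cong)

lemma trace_mat_comm:
  assumes "U \<in> carrier_mat n m" "V \<in> carrier_mat m n"
  shows "trace_mat (U * V) = trace_mat (V * U)"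
proof -
  have "trace_mat (U * V) = (\<Sum>i<n. \<Sum>j<m. U $$ (i, j) * V $$ (j, i))"
    using assms by (auto simp: trace_mat_def scalar_prod_def lessThan_atLeast0 intro!: sum.cong)
  also have "\<dots> = (\<Sum>j<m. \<Sum>i<n. V $$ (j, i) * U $$ (i, j))"
    by (subst sum.swap) (simp add: mult.commute)
  also have "\<dots> = trace_mat (V * U)"
    using assms by (auto simp: trace_mat_def scalar_prod_def lessThan_atLeast0 intro!: sum.cong)
  finally show ?thesis .
qed

lemma trace_mat_transpose:
  "A \<in> carrier_mat n n \<Longrightarrow> trace_mat (transpose_mat A) = trace_mat A"
  by (auto simp: trace_mat_def)

lemma trace_mat_add:
  "A \<in> carrier_mat n n \<Longrightarrow> B \<in> carrier_mat n n \<Longrightarrow> trace_mat (A + B) = trace_mat A + trace_mat B"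
  by (auto simp: trace_mat_def sum.distrib)

text \<open>The weighted trace form on matrices is a sum of copies of the form of \<open>A\<close> on vectors, one per
  column. Its positivity and its definiteness therefore reduce to those of \<open>A\<close>.\<close>

lemma metric_columns:
  assumes A: "A \<in> carrier_mat n n" and c: "U \<in> carrier_mat n m" "V \<in> carrier_mat n m"
  shows "metric A U V = (\<Sum>j<m. col U j \<bullet> (A *\<^sub>v col V j))"
proof -
  have "metric A U V = trace_mat (transpose_mat U * (A * V))"
    using assms by (simp add: metric_def assoc_mult_mat[of _ m n _ n _ m])
  also have "\<dots> = (\<Sum>j<m. col U j \<bullet> col (A * V) j)"
    using assms by (intro trace_mat_transpose_mult) auto
  also have "\<dots> = (\<Sum>j<m. col U j \<bullet> (A *\<^sub>v col V j))"
    using assms by (intro sum.cong refl) (simp add: col_mult2[of _ n n _ m])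
  finally show ?thesis .
qed

lemma metric_nonneg:
  assumes "spd_mat n A" "U \<in> carrier_mat n m"
  shows "metric A U U \<ge> 0"
  using assms spd_matD[OF assms(1)]
  by (auto simp: metric_columns[of _ n _ m] intro!: sum_nonneg)

lemma metric_definite:
  assumes A: "spd_mat n A" and U: "U \<in> carrier_mat n m" and 0: "metric A U U = 0"
  shows "U = 0\<^sub>m n m"
proof (rule eq_matI)
  fix i j assume "i < dim_row (0\<^sub>m n m :: real mat)" "j < dim_col (0\<^sub>m n m :: real mat)"
  then have ij: "i < n" "j < m" by auto
  have "(\<Sum>j<m. col U j \<bullet> (A *\<^sub>v col U j)) = 0"
    using 0 metric_columns[OF spd_matD(1)[OF A] U U] by simp
  then have "col U j \<bullet> (A *\<^sub>v col U j) = 0"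
    using ij U spd_matD(4)[OF A] by (subst (asm) sum_nonneg_eq_0_iff) auto
  then have "col U j = 0\<^sub>v n"
    using spd_matD(3)[OF A, of "col U j"] U by fastforce
  then show "U $$ (i, j) = (0\<^sub>m n m :: real mat) $$ (i, j)"
    using U ij by (metis carrier_matD index_col index_zero_mat(1) index_zero_vec(1))
qed (use U in auto)

lemma metric_sym:
  assumes A: "spd_mat n A" and c: "U \<in> carrier_mat n m" "V \<in> carrier_mat n m"
  shows "metric A U V = metric A V U"
proof -
  note Ac = spd_matD(1)[OF A]
  have "metric A U V = trace_mat (transpose_mat (transpose_mat U * A * V))"
    unfolding metric_def using Ac c by (subst trace_mat_transpose[of _ m]) auto
  also have "transpose_mat (transpose_mat U * A * V) = transpose_mat V * A * U"
    by (rule transpose_mult_sym_mult[OF Ac spd_matD(2)[OF A] c])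
  finally show ?thesis by (simp add: metric_def)
qed

lemma metric_diff_left:
  assumes "A \<in> carrier_mat n n" "U \<in> carrier_mat n m" "U' \<in> carrier_mat n m" "V \<in> carrier_mat n m"
  shows "metric A (U - U') V = metric A U V - metric A U' V"
proof -
  have "col (U - U') j = col U j - col U' j" if "j < m" for j
    using that assms by (intro eq_vecI) auto
  then show ?thesis
    using assms
    by (simp add: metric_columns[of _ n _ m] minus_scalar_prod_distrib[of _ n] sum_subtractf
        minus_carrier_mat)
qed


section \<open>The Sylvester equation\<close>

text \<open>Pair the equation with \<open>S\<close>: by cyclicity of the trace,
  \<open>0 = Tr (S\<^sup>T (A S + S A)) = Tr (S\<^sup>T A S) + Tr (S A S\<^sup>T)\<close>. Both summands are values of the
  nonnegative form of \<open>A\<close>, so both vanish, and the form is definite.\<close>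

lemma sylvester_kernel:
  assumes A: "spd_mat n A" and S: "S \<in> carrier_mat n n" and eq: "A * S + S * A = 0\<^sub>m n n"
  shows "S = 0\<^sub>m n n"
proof -
  note c = spd_matD(1)[OF A] S
  let ?St = "transpose_mat S"
  have "metric A S S + metric A ?St ?St = trace_mat (?St * A * S) + trace_mat (S * A * ?St)"
    by (simp add: metric_def)
  also have "trace_mat (S * A * ?St) = trace_mat (?St * (S * A))"
    using c by (intro trace_mat_comm[of _ n n]) auto
  also have "trace_mat (?St * A * S) + \<dots> = trace_mat (?St * (A * S) + ?St * (S * A))"
    using c by (subst trace_mat_add[of _ n]) (auto simp: assoc_mult_mat[of _ n n _ n _ n])
  also have "?St * (A * S) + ?St * (S * A) = ?St * (A * S + S * A)"
    using c by (subst mult_add_distrib_mat[of _ n n _ n]) auto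
  also have "trace_mat \<dots> = 0"
    using S by (simp add: eq) (simp add: trace_mat_def)
  finally have "metric A S S = 0"
    using metric_nonneg[OF A S] metric_nonneg[OF A, of ?St n] S by auto
  then show ?thesis by (rule metric_definite[OF A S])
qed

lemma row_major_index_less:
  assumes "i < m" "j < n" shows "i * n + j < m * (n :: nat)"
proof -
  have "i * n + j < Suc i * n" using assms by simp
  also have "\<dots> \<le> m * n" using assms by (intro mult_right_mono) auto
  finally show ?thesis .
qed

lemma div_mod_less:
  assumes "r < m * (n :: nat)" shows "r div n < m" "r mod n < n"
  using assms by (cases "n = 0"; auto simp: less_mult_imp_div_less)+

lemma sum_div_mod:
  fixes f :: "nat \<Rightarrow> nat \<Rightarrow> 'a :: comm_monoid_add"
  shows "(\<Sum>q<n * m. f (q div m) (q mod m)) = (\<Sum>k<n. \<Sum>l<m. f k l)"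
proof -
  have "(\<Sum>q<n * m. f (q div m) (q mod m)) = (\<Sum>(k, l)\<in>{..<n} \<times> {..<m}. f k l)"
  proof (rule sum.reindex_bij_witness[of _ "\<lambda>(k, l). k * m + l" "\<lambda>q. (q div m, q mod m)"])
    fix q assume "q \<in> {..<n * m}"
    then show "(q div m, q mod m) \<in> {..<n} \<times> {..<m}" using div_mod_less by auto
  next
    fix kl assume "kl \<in> {..<n} \<times> {..<m}"
    then show "(case kl of (k, l) \<Rightarrow> k * m + l) \<in> {..<n * m}" using row_major_index_less by auto
  qed auto
  then show ?thesis by (simp add: sum.cartesian_product)
qed

text \<open>The map \<open>S \<mapsto> A S + S A\<close> is linear on a space of finite dimension and has trivial kernel, so it
  is bijective. To apply the criterion by determinants, the map is written as a square matrix \<open>K\<close>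
  of size \<open>n\<^sup>2\<close> that acts on the entries of \<open>S\<close> in row-major order; \<open>K\<close> is the Kronecker sum
  of \<open>A\<close> with \<open>A\<^sup>T\<close>.\<close>

lemma sylvester_unique_solution:
  assumes A: "spd_mat n A" and F: "F \<in> carrier_mat n n"
  shows "\<exists>!S. is_sylvester_solution n A A F S"
proof -
  note Ac = spd_matD(1)[OF A]
  define K where "K = mat (n * n) (n * n) (\<lambda>(r, q).
     (if r mod n = q mod n then A $$ (r div n, q div n) else 0) +
     (if r div n = q div n then A $$ (q mod n, r mod n) else 0))"
  define unvec where "unvec v = mat n n (\<lambda>(i, j). v $ (i * n + j))" for v :: "real vec"
  have Kc: "K \<in> carrier_mat (n * n) (n * n)" by (simp add: K_def)
  note lt = row_major_index_less[of _ n _ n] and divmod = div_mod_less[of _ n n]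
  have uc: "unvec v \<in> carrier_mat n n" for v by (simp add: unvec_def)
  have K_unvec: "(K *\<^sub>v v) $ r = (A * unvec v + unvec v * A) $$ (r div n, r mod n)"
    if v: "v \<in> carrier_vec (n * n)" and r: "r < n * n" for v r
  proof -
    have "(K *\<^sub>v v) $ r = (\<Sum>q<n * n. K $$ (r, q) * v $ q)"
      using v r Kc by (auto simp: scalar_prod_def lessThan_atLeast0 intro!: sum.cong)
    also have "\<dots> = (\<Sum>q<n * n.
        ((if r mod n = q mod n then A $$ (r div n, q div n) else 0) +
         (if r div n = q div n then A $$ (q mod n, r mod n) else 0)) * v $ (q div n * n + q mod n))"
      using r by (intro sum.cong) (auto simp: K_def)
    also have "\<dots> = (\<Sum>k<n. \<Sum>l<n.
        ((if r mod n = l then A $$ (r div n, k) else 0) +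
         (if r div n = k then A $$ (l, r mod n) else 0)) * v $ (k * n + l))"
      by (rule sum_div_mod)
    also have "\<dots> = (\<Sum>k<n. A $$ (r div n, k) * v $ (k * n + r mod n)) +
        (\<Sum>k<n. \<Sum>l<n. (if r div n = k then A $$ (l, r mod n) * v $ (k * n + l) else 0))"
      using divmod[OF r]
      by (simp add: distrib_right sum.distrib if_distrib[of "\<lambda>x. x * _"] sum.delta' cong: if_cong)
    also have "(\<Sum>k<n. \<Sum>l<n. (if r div n = k then A $$ (l, r mod n) * v $ (k * n + l) else 0))
        = (\<Sum>l<n. A $$ (l, r mod n) * v $ (r div n * n + l))"
      using divmod[OF r] by (subst sum.swap) simp
    also have "(\<Sum>k<n. A $$ (r div n, k) * v $ (k * n + r mod n)) + \<dots>
        = (A * unvec v + unvec v * A) $$ (r div n, r mod n)"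
      using divmod[OF r] Ac
      by (simp add: unvec_def scalar_prod_def lessThan_atLeast0 mult.commute)
    finally show ?thesis .
  qed
  have inj: "v = 0\<^sub>v (n * n)" if v: "v \<in> carrier_vec (n * n)" and Kv: "K *\<^sub>v v = 0\<^sub>v (n * n)" for v
  proof -
    have "A * unvec v + unvec v * A = 0\<^sub>m n n"
    proof (rule eq_matI)
      fix i j assume "i < dim_row (0\<^sub>m n n :: real mat)" "j < dim_col (0\<^sub>m n n :: real mat)"
      then have ij: "i < n" "j < n" by auto
      show "(A * unvec v + unvec v * A) $$ (i, j) = (0\<^sub>m n n :: real mat) $$ (i, j)"
        using K_unvec[OF v lt[OF ij]] lt[OF ij] ij Kv by simp
    qed (use Ac uc in auto)
    then have "unvec v = 0\<^sub>m n n" by (rule sylvester_kernel[OF A uc])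
    then have *: "unvec v $$ (q div n, q mod n) = 0" if "q < n * n" for q using divmod[OF that] by simp
    show ?thesis
      by (rule eq_vecI) (use v * divmod in \<open>auto simp: unvec_def\<close>)
  qed
  note Ki = mat_inv_of_injective[OF Kc inj]
  define f where "f = vec (n * n) (\<lambda>q. F $$ (q div n, q mod n))"
  define v where "v = mat_inv K *\<^sub>v f"
  have v: "v \<in> carrier_vec (n * n)" using Ki by (simp add: v_def f_def)
  have Kv: "K *\<^sub>v v = f"
  proof -
    have "K *\<^sub>v v = (K * mat_inv K) *\<^sub>v f" unfolding v_def
      using Kc Ki(1) by (subst assoc_mult_mat_vec[of _ "n*n" "n*n" _ "n*n"]) (auto simp: f_def)
    also have "\<dots> = f" using Ki by (simp add: f_def)
    finally show ?thesis .
  qed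
  have sol: "is_sylvester_solution n A A F (unvec v)"
    unfolding is_sylvester_solution_def
  proof (intro conjI uc eq_matI)
    fix i j assume "i < dim_row F" "j < dim_col F"
    then have ij: "i < n" "j < n" using F by auto
    show "(A * unvec v + unvec v * A) $$ (i, j) = F $$ (i, j)"
      using K_unvec[OF v lt[OF ij]] lt[OF ij] ij Kv by (simp add: f_def)
  qed (use Ac uc F in auto)
  show ?thesis
  proof (intro ex1I[where a = "unvec v"] sol)
    fix S assume "is_sylvester_solution n A A F S"
    then have S: "S \<in> carrier_mat n n" and eq: "A * S + S * A = A * unvec v + unvec v * A"
      using sol by (auto simp: is_sylvester_solution_def)
    \<comment> \<open>The difference of two solutions lies in the kernel.\<close>
    have "A * (S - unvec v) + (S - unvec v) * A = (A * S - A * unvec v) + (S * A - unvec v * A)"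
      using Ac S uc by (simp add: mult_minus_distrib_mat[of _ n n] minus_mult_distrib_mat[of _ n n])
    also have "\<dots> = (A * S + S * A) - (A * unvec v + unvec v * A)"
      using Ac S uc[of v] by (intro eq_matI) auto
    also have "\<dots> = 0\<^sub>m n n" unfolding eq using Ac uc[of v] by (intro eq_matI) auto
    finally have "S - unvec v = 0\<^sub>m n n"
      using sylvester_kernel[OF A minus_carrier_mat[OF uc]] by simp
    then have "S $$ (i, j) - unvec v $$ (i, j) = 0" if "i < n" "j < n" for i j
      using that S uc[of v] by (metis carrier_matD index_minus_mat(1) index_zero_mat(1))
    then show "S = unvec v" using S uc[of v] by (intro eq_matI) auto
  qed
qed


section \<open>The two orthogonal projections\<close>

text \<open>The difference of two projections is orthogonal to \<open>V\<close>, in particular to both projections and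
  hence to itself.\<close>

lemma is_orth_proj_unique:
  assumes G: "spd_mat n G" and V: "V \<subseteq> carrier_mat n m" and \<xi>: "\<xi> \<in> carrier_mat n m"
    and \<eta>: "is_orth_proj (metric G) V \<xi> \<eta>" and \<eta>': "is_orth_proj (metric G) V \<xi> \<eta>'"
  shows "\<eta> = \<eta>'"
proof -
  note Gc = spd_matD(1)[OF G]
  have c: "\<eta> \<in> carrier_mat n m" "\<eta>' \<in> carrier_mat n m"
    using \<eta> \<eta>' V by (auto simp: is_orth_proj_def)
  define D where "D = \<eta> - \<eta>'"
  have Dc: "D \<in> carrier_mat n m" using c by (simp add: D_def minus_carrier_mat)
  have D: "D = (\<xi> - \<eta>') - (\<xi> - \<eta>)" unfolding D_def using c \<xi> by (intro eq_matI) auto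
  have "metric G D v = 0" if "v \<in> V" for v
    using \<eta> \<eta>' that V c unfolding D
    by (subst metric_diff_left[OF Gc, of _ m]) (auto simp: is_orth_proj_def minus_carrier_mat)
  then have "metric G D \<eta> = 0" "metric G D \<eta>' = 0"
    using \<eta> \<eta>' by (auto simp: is_orth_proj_def)
  then have "metric G \<eta> D - metric G \<eta>' D = 0"
    using metric_sym[OF G Dc c(1)] metric_sym[OF G Dc c(2)] by simp
  then have "metric G D D = 0"
    unfolding D_def using metric_diff_left[OF Gc c Dc] by (simp add: D_def)
  then have "D = 0\<^sub>m n m" by (rule metric_definite[OF G Dc])
  then have "\<eta> $$ (i, j) - \<eta>' $$ (i, j) = 0" if "i < n" "j < m" for i j
    using that c unfolding D_def by (metis carrier_matD index_minus_mat(1) index_zero_mat(1))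
  then show ?thesis using c by (intro eq_matI) auto
qed

lemma orth_proj_unique_eq:
  assumes "spd_mat n G" "V \<subseteq> carrier_mat n m" "\<xi> \<in> carrier_mat n m"
    and "is_orth_proj (metric G) V \<xi> \<eta>"
  shows "\<exists>!\<eta>. is_orth_proj (metric G) V \<xi> \<eta>" "orth_proj (metric G) V \<xi> = \<eta>"
  unfolding orth_proj_def using assms is_orth_proj_unique[OF assms(1-3)] by blast+

locale stiefel_point =
  fixes d p :: nat and B :: "real mat" and M :: "real mat \<Rightarrow> real mat" and X :: "real mat"
  assumes B: "spd_mat d B" and M: "spd_mat d (M X)" and X: "X \<in> stiefel d p B"
begin

abbreviation "W \<equiv> mat_inv (M X)"
abbreviation "A \<equiv> transpose_mat X * B * W * B * X"

lemma carriers: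
  "X \<in> carrier_mat d p" "B \<in> carrier_mat d d" "W \<in> carrier_mat d d" "M X \<in> carrier_mat d d"
  using X spd_matD(1)[OF B] spd_mat_inv(1)[OF M] spd_matD(1)[OF M] by (auto simp: stiefel_def)

lemma transpose_BX: "transpose_mat (B * X) = transpose_mat X * B"
  using carriers spd_matD(2)[OF B] by (simp add: transpose_mult[of _ d d])

lemma A_eq: "A = transpose_mat (B * X) * W * (B * X)"
  unfolding transpose_BX using carriers
  by (simp add: assoc_mult_mat[of _ p d _ d _ p] assoc_mult_mat[of _ p d _ d _ d] assoc_mult_mat[of _ d d _ d _ p])

text \<open>\<open>A\<close> is the congruence of \<open>M\<^sub>X\<^sup>-\<^sup>1\<close> by \<open>B X\<close>, which has full column rank because
  \<open>X\<^sup>T\<close> is a left inverse of it on the manifold.\<close>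

lemma spd_A: "spd_mat p A"
  unfolding A_eq
proof (rule spd_mat_congruence[OF spd_mat_inv_spd[OF M]])
  fix v assume v: "v \<in> carrier_vec p" and "(B * X) *\<^sub>v v = 0\<^sub>v d"
  then have "transpose_mat X *\<^sub>v ((B * X) *\<^sub>v v) = 0\<^sub>v p"
    using carriers by (simp only:) (intro eq_vecI, auto)
  moreover have "transpose_mat X *\<^sub>v ((B * X) *\<^sub>v v) = (transpose_mat X * (B * X)) *\<^sub>v v"
    using carriers v by (intro assoc_mult_mat_vec[symmetric, of _ p d _ p]) auto
  moreover have "transpose_mat X * (B * X) = 1\<^sub>m p"
    using X carriers by (simp add: stiefel_def assoc_mult_mat[of _ p d _ d _ p])
  ultimately show "v = 0\<^sub>v p" using v by simp
qed (use carriers in auto)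

text \<open>As \<open>B\<close> is symmetric, \<open>Z\<close> is tangent exactly when \<open>X\<^sup>T B Z\<close> is skew-symmetric.\<close>

lemma tangent_space_iff:
  "Z \<in> tangent_space d p B X \<longleftrightarrow> Z \<in> carrier_mat d p \<and>
     transpose_mat (transpose_mat X * B * Z) + transpose_mat X * B * Z = 0\<^sub>m p p"
  using transpose_mult_sym_mult[OF carriers(2) spd_matD(2)[OF B] carriers(1), of Z p]
  by (auto simp: tangent_space_def)

context
  fixes \<xi> S :: "real mat"
  assumes \<xi>: "\<xi> \<in> carrier_mat d p"
    and S: "is_sylvester_solution p A A
      (transpose_mat X * B * \<xi> + transpose_mat (transpose_mat X * B * \<xi>)) S"
begin

lemma A_carrier: "A \<in> carrier_mat p p" and A_sym: "transpose_mat A = A"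
  using spd_matD[OF spd_A] by auto

lemma S_carrier: "S \<in> carrier_mat p p"
  and S_eq: "A * S + S * A = transpose_mat X * B * \<xi> + transpose_mat (transpose_mat X * B * \<xi>)"
  using S by (auto simp: is_sylvester_solution_def)

text \<open>The transpose of \<open>S\<close> solves the same equation, since \<open>A\<close> and the right-hand side are symmetric.\<close>

lemma S_sym: "transpose_mat S = S"
proof -
  define H where "H = transpose_mat X * B * \<xi>"
  have H: "H \<in> carrier_mat p p" using carriers \<xi> by (simp add: H_def)
  note c = A_carrier S_carrier
  have "A * transpose_mat S + transpose_mat S * A = transpose_mat (A * S + S * A)"
    using c by (subst transpose_add[of _ p p])
      (auto simp: transpose_mult[of _ p p _ p] A_sym intro!: comm_add_mat[of _ p p])
  also have "\<dots> = H + transpose_mat H"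
    unfolding S_eq H_def[symmetric] using H
    by (subst transpose_add[of _ p p]) (auto intro!: comm_add_mat[of _ p p])
  finally have "is_sylvester_solution p A A (H + transpose_mat H) (transpose_mat S)"
    using c by (simp add: is_sylvester_solution_def)
  moreover have "\<exists>!S. is_sylvester_solution p A A (H + transpose_mat H) S"
    using H by (intro sylvester_unique_solution spd_A) auto
  ultimately show ?thesis using S unfolding H_def by blast
qed

definition "normal_part = W * B * X * S"

lemma normal_part_carrier: "normal_part \<in> carrier_mat d p"
  unfolding normal_part_def using carriers S_carrier by (metis mult_carrier_mat)

text \<open>For tangent \<open>Z\<close> the metric pairing collapses, by \<open>M\<^sub>X\<^sup>-\<^sup>1 M\<^sub>X = 1\<close>, to the trace of
  \<open>S (X\<^sup>T B Z)\<close>, a product of a symmetric and a skew-symmetric matrix.\<close>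

lemma normal_part_in_normal_space: "normal_part \<in> normal_space d p B M X"
  unfolding normal_space_def
proof (intro CollectI conjI ballI normal_part_carrier)
  fix Z assume Z: "Z \<in> tangent_space d p B X"
  define K where "K = transpose_mat X * B * Z"
  have Zc: "Z \<in> carrier_mat d p" using Z by (simp add: tangent_space_iff)
  note c = carriers S_carrier Zc
  have Kc: "K \<in> carrier_mat p p" using c by (simp add: K_def)
  have "transpose_mat normal_part = S * (transpose_mat X * (B * W))"
    using c transpose_mult[of "W * B * X" d p S p] transpose_mult[of "W * B" d d X p]
      transpose_mult[of W d d B d]
    by (simp add: normal_part_def S_sym spd_matD(2)[OF B] spd_matD(2)[OF spd_mat_inv_spd[OF M]])
  then have "transpose_mat normal_part * M X = S * (transpose_mat X * (B * (W * M X)))"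
    using c by (simp add: assoc_mult_mat[of _ p p _ d _ d] assoc_mult_mat[of _ p d _ d _ d]
        assoc_mult_mat[of _ d d _ d _ d])
  then have "transpose_mat normal_part * M X * Z = S * K"
    using c spd_mat_inv(3)[OF M]
    by (simp add: K_def assoc_mult_mat[of _ p p _ d _ p] assoc_mult_mat[of _ p d _ d _ p])
  then have "metric (M X) normal_part Z = trace_mat (S * K)" by (simp add: metric_def)
  also have "\<dots> = 0"
  proof -
    have "trace_mat (S * transpose_mat K) = trace_mat (transpose_mat (K * S))"
      using S_carrier Kc by (simp add: transpose_mult[of _ p p _ p] S_sym)
    also have "\<dots> = trace_mat (K * S)" using S_carrier Kc by (intro trace_mat_transpose[of _ p]) auto
    also have "\<dots> = trace_mat (S * K)" by (rule trace_mat_comm[OF Kc S_carrier])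
    \<comment> \<open>Transposing \<open>S K\<^sup>T\<close> shows that both halves are equal, while \<open>K\<^sup>T + K = 0\<close>.\<close>
    finally have "2 * trace_mat (S * K) = trace_mat (S * transpose_mat K) + trace_mat (S * K)" by simp
    also have "\<dots> = trace_mat (S * transpose_mat K + S * K)"
      using S_carrier Kc by (intro trace_mat_add[symmetric, of _ p]) auto
    also have "S * transpose_mat K + S * K = S * (transpose_mat K + K)"
      using S_carrier Kc by (intro mult_add_distrib_mat[symmetric, of _ p p _ p]) auto
    also have "trace_mat \<dots> = 0"
      using Z S_carrier by (simp add: tangent_space_iff K_def) (simp add: trace_mat_def)
    finally show ?thesis by simp
  qed
  finally show "metric (M X) normal_part Z = 0" .
qed

text \<open>The Sylvester equation is this statement in disguise: \<open>X\<^sup>T B\<close> maps the candidate for the normal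
  part to \<open>A S\<close>, so the symmetric part of \<open>X\<^sup>T B\<close> applied to the remainder is, up to the factor 2,
  the difference of the two sides of the equation.\<close>

lemma tangent_part_in_tangent_space: "\<xi> - normal_part \<in> tangent_space d p B X"
  unfolding tangent_space_iff
proof
  define H where "H = transpose_mat X * B * \<xi>"
  note c = carriers S_carrier \<xi> A_carrier
  have H: "H \<in> carrier_mat p p" using c by (simp add: H_def)
  show "\<xi> - normal_part \<in> carrier_mat d p" using normal_part_carrier by (simp add: minus_carrier_mat)
  have "transpose_mat X * B * normal_part = A * S"
    using c by (simp add: normal_part_def assoc_mult_mat[of _ p d _ d _ p]
        assoc_mult_mat[of _ d d _ d _ p] assoc_mult_mat[of _ d d _ d _ d]
        assoc_mult_mat[of _ d p _ p _ p] assoc_mult_mat[of _ p d _ p _ p] assoc_mult_mat[of _ p d _ d _ d]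
        assoc_mult_mat[of _ d d _ p _ p])
  then have R: "transpose_mat X * B * (\<xi> - normal_part) = H - A * S"
    using c normal_part_carrier by (simp add: H_def mult_minus_distrib_mat[of _ p d _ p])
  have AS: "A * S \<in> carrier_mat p p" "transpose_mat (A * S) = S * A"
    using transpose_mult[OF A_carrier S_carrier] mult_carrier_mat[OF A_carrier S_carrier]
    by (simp_all only: S_sym A_sym)
  have "transpose_mat (H - A * S) + (H - A * S) = (transpose_mat H - S * A) + (H - A * S)"
    by (simp only: transpose_minus[OF H AS(1)] AS(2))
  also have "\<dots> = (H + transpose_mat H) - (A * S + S * A)"
    using c(5) A_carrier H by (intro eq_matI) auto
  also have "\<dots> = 0\<^sub>m p p" unfolding S_eq H_def[symmetric] using H by (intro eq_matI) auto
  finally show "transpose_mat (transpose_mat X * B * (\<xi> - normal_part))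
      + transpose_mat X * B * (\<xi> - normal_part) = 0\<^sub>m p p"
    unfolding R .
qed

lemma is_orth_proj_normal: "is_orth_proj (metric (M X)) (normal_space d p B M X) \<xi> normal_part"
  using normal_part_in_normal_space tangent_part_in_tangent_space normal_part_carrier \<xi>
  by (auto simp: is_orth_proj_def normal_space_def metric_sym[OF M, of "\<xi> - normal_part" p]
      minus_carrier_mat)

lemma is_orth_proj_tangent:
  "is_orth_proj (metric (M X)) (tangent_space d p B X) \<xi> (\<xi> - normal_part)"
proof -
  have "\<xi> - (\<xi> - normal_part) = normal_part"
    using \<xi> normal_part_carrier by (intro eq_matI) auto
  then show ?thesis
    using normal_part_in_normal_space tangent_part_in_tangent_space
    by (auto simp: is_orth_proj_def normal_space_def)
qed

lemmas orth_proj_normal =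
  orth_proj_unique_eq[OF M _ \<xi> is_orth_proj_normal, unfolded normal_part_def]
lemmas orth_proj_tangent =
  orth_proj_unique_eq[OF M _ \<xi> is_orth_proj_tangent, unfolded normal_part_def]

end

lemma normal_space_carrier: "normal_space d p B M X \<subseteq> carrier_mat d p"
  and tangent_space_carrier: "tangent_space d p B X \<subseteq> carrier_mat d p"
  by (auto simp: normal_space_def tangent_space_def)

lemma sylvester_solvable:
  assumes "\<xi> \<in> carrier_mat d p"
  shows "\<exists>!S. is_sylvester_solution p A A
      (transpose_mat X * B * \<xi> + transpose_mat (transpose_mat X * B * \<xi>)) S"
  using carriers assms by (intro sylvester_unique_solution spd_A) auto

end


section \<open>Running programs blockwise\<close>

lemma run_append: "run step s cs s' \<Longrightarrow> run step s' cs' s'' \<Longrightarrow> run step s (cs @ cs') s''"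
  by (induction rule: run.induct) (auto intro: run.intros)

lemma run_single: "step s c vs \<Longrightarrow> run step s [c] (s @ vs)"
  by (auto intro: run.intros)

lemma length_concat_blocks:
  "(\<And>k. k < n \<Longrightarrow> length (u k) = w) \<Longrightarrow> length (concat (map u [0..<n])) = n * w"
  by (induction n) auto

lemma nth_concat_blocks:
  "(\<And>k. k < n \<Longrightarrow> length (u k) = w) \<Longrightarrow> k < n \<Longrightarrow> r < w \<Longrightarrow>
    concat (map u [0..<n]) ! (k * w + r) = u k ! r"
proof (induction n)
  case (Suc n)
  have len: "length (concat (map u [0..<n])) = n * w"
    using Suc.prems by (intro length_concat_blocks) auto
  show ?case
  proof (cases "k = n")
    case False
    with Suc.prems have "k < n" by auto
    then have "Suc k * w \<le> n * w" by (intro mult_right_mono) auto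
    then have "k * w + r < n * w" using Suc.prems by simp
    then show ?thesis using Suc \<open>k < n\<close> by (simp add: nth_append len)
  qed (use len Suc.prems in \<open>simp add: nth_append\<close>)
qed auto

text \<open>A loop whose iterations each append \<open>w\<close> values, so that the code of iteration \<open>k\<close> can refer to
  its own intermediate results at fixed positions. The values \<open>u k\<close> do not depend on the results
  \<open>t\<close> of the earlier iterations: each iteration below reads, besides its own results, only what
  was there before the loop started.\<close>

lemma run_blocks:
  assumes "\<And>k t. k < n \<Longrightarrow> length t = k * w \<Longrightarrow> run step (s @ t) (frag k) (s @ t @ u k)"
    and "\<And>k. k < n \<Longrightarrow> length (u k) = w"
  shows "run step s (concat (map frag [0..<n])) (s @ concat (map u [0..<n]))"
  using assms
proof (induction n)
  case (Suc n)
  have "run step s (concat (map frag [0..<n])) (s @ concat (map u [0..<n]))"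
    using Suc by auto
  moreover have "run step (s @ concat (map u [0..<n])) (frag n) (s @ concat (map u [0..<n]) @ u n)"
    using Suc.prems by (intro Suc.prems(1) length_concat_blocks) auto
  ultimately show ?case by (auto intro: run_append)
qed (auto intro: run.intros)


section \<open>Matrices in the state\<close>

text \<open>The position function makes the layout of a matrix explicit. Transposing a stored matrix then
  costs nothing: it only swaps the arguments of the function.\<close>

definition stores :: "real list \<Rightarrow> nat \<Rightarrow> nat \<Rightarrow> (nat \<Rightarrow> nat \<Rightarrow> nat) \<Rightarrow> real mat \<Rightarrow> bool" where
  "stores s m n a A \<longleftrightarrow> A \<in> carrier_mat m n \<and>
     (\<forall>i < m. \<forall>j < n. a i j < length s \<and> s ! a i j = A $$ (i, j))"

definition row_major :: "nat \<Rightarrow> nat \<Rightarrow> nat \<Rightarrow> nat \<Rightarrow> nat" where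
  "row_major l n i j = l + (i * n + j)"

definition col_major :: "nat \<Rightarrow> nat \<Rightarrow> nat \<Rightarrow> nat \<Rightarrow> nat" where
  "col_major l m i j = l + (j * m + i)"

definition positions :: "nat \<Rightarrow> nat \<Rightarrow> (nat \<Rightarrow> nat \<Rightarrow> nat) \<Rightarrow> nat list" where
  "positions m n a = map (\<lambda>r. a (r div n) (r mod n)) [0..<m * n]"

lemma stores_append: "stores s m n a A \<Longrightarrow> stores (s @ t) m n a A"
  by (auto simp: stores_def nth_append intro: trans_less_add1)

lemma stores_transpose: "stores s m n a A \<Longrightarrow> stores s n m (\<lambda>i j. a j i) (transpose_mat A)"
  by (auto simp: stores_def)

lemma entries_conv_map:
  assumes A: "A \<in> carrier_mat m n"
  shows "entries A = map (\<lambda>r. A $$ (r div n, r mod n)) [0..<m * n]"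
proof -
  define u where "u = (\<lambda>i. map (\<lambda>j. A $$ (i, j)) [0..<n])"
  have u: "length (u i) = n" for i by (simp add: u_def)
  have e: "entries A = concat (map u [0..<m])"
    using A by (simp add: entries_def mat_to_list_def u_def)
  show ?thesis
  proof (rule nth_equalityI)
    show "length (entries A) = length (map (\<lambda>r. A $$ (r div n, r mod n)) [0..<m * n])"
      unfolding e by (subst length_concat_blocks[OF u]) auto
  next
    fix r assume "r < length (entries A)"
    then have r: "r < m * n" unfolding e by (subst (asm) length_concat_blocks[OF u]) auto
    have "entries A ! (r div n * n + r mod n) = u (r div n) ! (r mod n)"
      unfolding e using div_mod_less[OF r] by (intro nth_concat_blocks u)
    then show "entries A ! r = map (\<lambda>r. A $$ (r div n, r mod n)) [0..<m * n] ! r"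
      using r div_mod_less[OF r] by (simp add: u_def)
  qed
qed

lemma length_entries: "A \<in> carrier_mat m n \<Longrightarrow> length (entries A) = m * n"
  by (simp add: entries_conv_map)

lemma stores_read_at: "stores s m n a A \<Longrightarrow> read_at s (positions m n a) (entries A)"
  using div_mod_less[of _ m n]
  by (auto simp: stores_def read_at_def positions_def entries_conv_map)

lemma stores_entries:
  assumes "A \<in> carrier_mat m n"
  shows "stores (s @ entries A @ t) m n (row_major (length s) n) A"
  using assms row_major_index_less[of _ m _ n]
  by (auto simp: stores_def row_major_def nth_append entries_conv_map intro: trans_less_add1)

text \<open>Straight-line code addresses the state by absolute positions, so the code that follows must know
  how many values \<open>cs\<close> appends, whatever the input is. This is the reason for the parameter \<open>len\<close>.\<close>

definition extends_with ::
    "real mat \<Rightarrow> real mat \<Rightarrow> real list \<Rightarrow> instr list \<Rightarrow> nat \<Rightarrow>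
      nat \<Rightarrow> nat \<Rightarrow> (nat \<Rightarrow> nat \<Rightarrow> nat) \<Rightarrow> real mat \<Rightarrow> bool" where
  "extends_with B W s cs len m n a A \<longleftrightarrow>
     (\<exists>t. run (instr_step B W) s cs (s @ t) \<and> length t = len \<and> stores (s @ t) m n a A)"


section \<open>Matrix operations as programs\<close>

text \<open>Position \<open>a\<close> holds the sum so far and \<open>l\<close> is the current length of the state. Each pair appends
  a product at \<open>l\<close> and the new sum at \<open>l + 1\<close>.\<close>

fun accumulate :: "nat \<Rightarrow> nat \<Rightarrow> (nat \<times> nat) list \<Rightarrow> instr list" where
  "accumulate a l [] = []"
| "accumulate a l ((i, j) # ps) =
     Arith (Mul i j) # Arith (Add a l) # accumulate (l + 1) (l + 2) ps"

fun partial_sums :: "real \<Rightarrow> (real \<times> real) list \<Rightarrow> real list" where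
  "partial_sums c [] = []"
| "partial_sums c ((x, y) # xs) = [x * y, c + x * y] @ partial_sums (c + x * y) xs"

lemma run_accumulate:
  assumes "length s = l" "a < l" "\<forall>(i, j) \<in> set ps. i < l \<and> j < l"
  shows "run (instr_step B W) s (accumulate a l ps)
     (s @ partial_sums (s ! a) (map (\<lambda>(i, j). (s ! i, s ! j)) ps))"
  using assms
proof (induction ps arbitrary: a l s)
  case Nil
  then show ?case by (auto intro: run.intros)
next
  case (Cons q ps)
  obtain i j where q: "q = (i, j)" by force
  define s' where "s' = s @ [s ! i * s ! j] @ [s ! a + s ! i * s ! j]"
  have "instr_step B W s (Arith (Mul i j)) [s ! i * s ! j]"
    using Cons.prems q by (intro instr_step.intros arith_step.intros) (auto simp: read_at_def)
  moreover have "instr_step B W (s @ [s ! i * s ! j]) (Arith (Add a l)) [s ! a + s ! i * s ! j]"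
    using Cons.prems q
    by (intro instr_step.intros arith_step.intros) (auto simp: read_at_def nth_append)
  moreover have "run (instr_step B W) s' (accumulate (l + 1) (l + 2) ps)
     (s' @ partial_sums (s ! a + s ! i * s ! j) (map (\<lambda>(i, j). (s ! i, s ! j)) ps))"
  proof -
    have "run (instr_step B W) s' (accumulate (l + 1) (l + 2) ps)
       (s' @ partial_sums (s' ! (l + 1)) (map (\<lambda>(i, j). (s' ! i, s' ! j)) ps))"
      using Cons.prems by (intro Cons.IH) (auto simp: s'_def)
    moreover have "s' ! (l + 1) = s ! a + s ! i * s ! j"
      using Cons.prems by (simp add: s'_def nth_append)
    moreover have "map (\<lambda>(i, j). (s' ! i, s' ! j)) ps = map (\<lambda>(i, j). (s ! i, s ! j)) ps"
      using Cons.prems by (fastforce simp: s'_def nth_append)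
    ultimately show ?thesis by simp
  qed
  ultimately show ?case
    by (auto simp: q s'_def intro!: run.intros)
qed

lemma length_partial_sums [simp]: "length (partial_sums c xs) = 2 * length xs"
  by (induction c xs rule: partial_sums.induct) auto

text \<open>With the initial value in front, the total is the last entry even when there are no summands.\<close>

lemma last_partial_sums:
  "(c # partial_sums c xs) ! (2 * length xs) = c + (\<Sum>(x, y)\<leftarrow>xs. x * y)"
  by (induction c xs rule: partial_sums.induct) auto

definition inner_product_prog :: "nat \<Rightarrow> (nat \<times> nat) list \<Rightarrow> instr list" where
  "inner_product_prog l ps = Arith (Const 0) # accumulate l (l + 1) ps"

lemma run_inner_product:
  assumes "length s = l" "\<forall>(i, j) \<in> set ps. i < l \<and> j < l"
  shows "run (instr_step B W) s (inner_product_prog l ps)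
     (s @ 0 # partial_sums 0 (map (\<lambda>(i, j). (s ! i, s ! j)) ps))"
proof -
  have "run (instr_step B W) (s @ [0]) (accumulate l (l + 1) ps)
     ((s @ [0]) @ partial_sums ((s @ [0]) ! l) (map (\<lambda>(i, j). ((s @ [0]) ! i, (s @ [0]) ! j)) ps))"
    using assms by (intro run_accumulate) auto
  moreover have "map (\<lambda>(i, j). ((s @ [0]) ! i, (s @ [0]) ! j)) ps = map (\<lambda>(i, j). (s ! i, s ! j)) ps"
    using assms by (fastforce simp: nth_append)
  ultimately show ?thesis
    using assms(1)
    by (auto simp: inner_product_prog_def intro!: run.intros instr_step.intros arith_step.intros)
qed

definition product_prog ::
    "nat \<Rightarrow> nat \<Rightarrow> nat \<Rightarrow> nat \<Rightarrow> (nat \<Rightarrow> nat \<Rightarrow> nat) \<Rightarrow> (nat \<Rightarrow> nat \<Rightarrow> nat) \<Rightarrow> instr list" where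
  "product_prog l m k n a b = concat (map (\<lambda>r. inner_product_prog (l + r * (2 * k + 1))
     (map (\<lambda>x. (a (r div n) x, b x (r mod n))) [0..<k])) [0..<m * n])"

text \<open>An inner product of length \<open>k\<close> appends the initial zero and two values per summand, which is
  \<open>2 * k + 1\<close> values, the last of which is the result.\<close>

definition product_position :: "nat \<Rightarrow> nat \<Rightarrow> nat \<Rightarrow> nat \<Rightarrow> nat \<Rightarrow> nat" where
  "product_position l k n i j = l + ((i * n + j) * (2 * k + 1) + 2 * k)"

lemma product_prog_correct:
  assumes s: "length s = l" and A: "stores s m k a A" and C: "stores s k n b C"
  shows "extends_with B W s (product_prog l m k n a b) (m * n * (2 * k + 1))
     m n (product_position l k n) (A * C)"
proof -
  define ps where "ps r = map (\<lambda>x. (a (r div n) x, b x (r mod n))) [0..<k]" for r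
  define u where "u r = (0::real) # partial_sums 0 (map (\<lambda>(i, j). (s ! i, s ! j)) (ps r))" for r
  have len: "length (u r) = 2 * k + 1" for r by (simp add: u_def ps_def)
  have ps: "\<forall>(i, j) \<in> set (ps r). i < l \<and> j < l" if "r < m * n" for r
    using A C s div_mod_less[OF that] by (auto simp: ps_def stores_def)
  have "run (instr_step B W) (s @ t) (inner_product_prog (l + r * (2 * k + 1)) (ps r)) (s @ t @ u r)"
    if r: "r < m * n" and t: "length t = r * (2 * k + 1)" for r t
  proof -
    have "run (instr_step B W) (s @ t) (inner_product_prog (l + r * (2 * k + 1)) (ps r))
      ((s @ t) @ 0 # partial_sums 0 (map (\<lambda>(i, j). ((s @ t) ! i, (s @ t) ! j)) (ps r)))"
      using s t ps[OF r] by (intro run_inner_product) fastforce+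
    moreover have "map (\<lambda>(i, j). ((s @ t) ! i, (s @ t) ! j)) (ps r) = map (\<lambda>(i, j). (s ! i, s ! j)) (ps r)"
      using ps[OF r] s by (fastforce simp: nth_append)
    ultimately show ?thesis by (simp add: u_def)
  qed
  then have "run (instr_step B W) s (product_prog l m k n a b) (s @ concat (map u [0..<m * n]))"
    unfolding product_prog_def ps_def[symmetric] by (rule run_blocks[OF _ len])
  moreover have len': "length (concat (map u [0..<m * n])) = m * n * (2 * k + 1)"
    by (rule length_concat_blocks[OF len])
  moreover have "stores (s @ concat (map u [0..<m * n])) m n (product_position l k n) (A * C)"
    unfolding stores_def
  proof (intro conjI allI impI)
    show "A * C \<in> carrier_mat m n" using A C by (auto simp: stores_def)
    fix i j assume ij: "i < m" "j < n"
    note r = row_major_index_less[OF ij]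
    show "product_position l k n i j < length (s @ concat (map u [0..<m * n]))"
      using row_major_index_less[OF r, of "2 * k" "2 * k + 1"]
      by (simp only: length_append len' s product_position_def) simp
    have "(s @ concat (map u [0..<m * n])) ! product_position l k n i j = u (i * n + j) ! (2 * k)"
      unfolding product_position_def s[symmetric] nth_append_length_plus
      by (rule nth_concat_blocks[OF len r]) simp
    also have "\<dots> = (\<Sum>(x, y)\<leftarrow>map (\<lambda>(i, j). (s ! i, s ! j)) (ps (i * n + j)). x * y)"
      using last_partial_sums[of 0 "map (\<lambda>(i, j). (s ! i, s ! j)) (ps (i * n + j))"]
      by (simp add: u_def ps_def)
    also have "\<dots> = (\<Sum>x\<leftarrow>[0..<k]. s ! a i x * s ! b x j)"
      using ij by (simp add: ps_def o_def)
    also have "\<dots> = (\<Sum>x\<in>{0..<k}. A $$ (i, x) * C $$ (x, j))"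
      using A C ij by (subst sum_list_distinct_conv_sum_set) (auto simp: stores_def)
    also have "\<dots> = (A * C) $$ (i, j)"
      using A C ij by (auto simp: stores_def scalar_prod_def)
    finally show "(s @ concat (map u [0..<m * n])) ! product_position l k n i j = (A * C) $$ (i, j)" .
  qed
  ultimately show ?thesis by (auto simp: extends_with_def)
qed

definition entrywise_prog ::
    "(nat \<Rightarrow> nat \<Rightarrow> arith) \<Rightarrow> nat \<Rightarrow> nat \<Rightarrow> (nat \<Rightarrow> nat \<Rightarrow> nat) \<Rightarrow> (nat \<Rightarrow> nat \<Rightarrow> nat) \<Rightarrow> instr list" where
  "entrywise_prog op m n a b =
     concat (map (\<lambda>r. [Arith (op (a (r div n) (r mod n)) (b (r div n) (r mod n)))]) [0..<m * n])"

lemma entrywise_prog_correct: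
  assumes op: "\<And>s i j. i < length s \<Longrightarrow> j < length s \<Longrightarrow> arith_step s (op i j) [f (s ! i) (s ! j)]"
    and s: "length s = l" and A: "stores s m n a A" and C: "stores s m n b C"
    and R: "R \<in> carrier_mat m n"
      "\<And>i j. i < m \<Longrightarrow> j < n \<Longrightarrow> R $$ (i, j) = f (A $$ (i, j)) (C $$ (i, j))"
  shows "extends_with B W s (entrywise_prog op m n a b) (m * n) m n (row_major l n) R"
proof -
  define u where "u = (\<lambda>r. [R $$ (r div n, r mod n)])"
  have "run (instr_step B W) (s @ t)
      [Arith (op (a (r div n) (r mod n)) (b (r div n) (r mod n)))] (s @ t @ u r)"
    if r: "r < m * n" for r t
  proof -
    note b = div_mod_less[OF r]
    have "arith_step (s @ t) (op (a (r div n) (r mod n)) (b (r div n) (r mod n)))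
      [f ((s @ t) ! (a (r div n) (r mod n))) ((s @ t) ! (b (r div n) (r mod n)))]"
      using b A C by (intro op) (auto simp: stores_def intro: trans_less_add1)
    moreover have "f ((s @ t) ! (a (r div n) (r mod n))) ((s @ t) ! (b (r div n) (r mod n)))
        = R $$ (r div n, r mod n)"
      using b A C R by (simp add: stores_def nth_append)
    ultimately show ?thesis
      using run_single[where step = "instr_step B W" and s = "s @ t"] by (auto simp: u_def intro: instr_step.intros)
  qed
  then have "run (instr_step B W) s (entrywise_prog op m n a b) (s @ concat (map u [0..<m * n]))"
    unfolding entrywise_prog_def by (intro run_blocks[where w = 1]) (auto simp: u_def)
  moreover have "concat (map u [0..<m * n]) = entries R"
    using R by (simp add: u_def entries_conv_map)
  ultimately show ?thesis
    using stores_entries[OF R(1), of s "[]"] s R by (auto simp: extends_with_def length_entries)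
qed

text \<open>The parameter \<open>call\<close> stands for one of the two multiplication routines, which is applied to each
  column. The resulting columns are appended one after the other.\<close>

definition columns_prog :: "(nat list \<Rightarrow> instr) \<Rightarrow> nat \<Rightarrow> nat \<Rightarrow> (nat \<Rightarrow> nat \<Rightarrow> nat) \<Rightarrow> instr list" where
  "columns_prog call m n a = concat (map (\<lambda>j. [call (map (\<lambda>i. a i j) [0..<m])]) [0..<n])"

lemma columns_prog_correct:
  assumes call: "\<And>s is v. read_at s is (list_of_vec v) \<Longrightarrow> v \<in> carrier_vec m \<Longrightarrow>
      instr_step B W s (call is) (list_of_vec (C *\<^sub>v v))"
    and C: "C \<in> carrier_mat m' m" and s: "length s = l" and A: "stores s m n a A"
  shows "extends_with B W s (columns_prog call m n a) (n * m') m' n (col_major l m') (C * A)"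
proof -
  have Ac: "A \<in> carrier_mat m n" using A by (simp add: stores_def)
  define u where "u j = list_of_vec (C *\<^sub>v col A j)" for j
  have len: "length (u j) = m'" for j using C by (simp add: u_def)
  have "run (instr_step B W) (s @ t) [call (map (\<lambda>i. a i j) [0..<m])] (s @ t @ u j)"
    if j: "j < n" for j t
  proof -
    have "read_at (s @ t) (map (\<lambda>i. a i j) [0..<m]) (list_of_vec (col A j))"
      using A j Ac by (auto simp: read_at_def stores_def nth_append list_of_vec_map intro: trans_less_add1)
    moreover have "col A j \<in> carrier_vec m" using Ac j by simp
    ultimately show ?thesis
      using run_single[where step = "instr_step B W" and s = "s @ t"] call by (auto simp: u_def)
  qed
  then have "run (instr_step B W) s (columns_prog call m n a) (s @ concat (map u [0..<n]))"
    unfolding columns_prog_def by (intro run_blocks[where u = u and w = m']) (auto simp: len)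
  moreover have len': "length (concat (map u [0..<n])) = n * m'"
    by (rule length_concat_blocks[OF len])
  moreover have "stores (s @ concat (map u [0..<n])) m' n (col_major l m') (C * A)"
    unfolding stores_def
  proof (intro conjI allI impI)
    show "C * A \<in> carrier_mat m' n" using C Ac by simp
    fix i j assume ij: "i < m'" "j < n"
    show "col_major l m' i j < length (s @ concat (map u [0..<n]))"
      using row_major_index_less[OF ij(2,1)] by (simp only: length_append len' s col_major_def)
    show "(s @ concat (map u [0..<n])) ! col_major l m' i j = (C * A) $$ (i, j)"
      unfolding col_major_def s[symmetric] nth_append_length_plus
      using nth_concat_blocks[where u = u, OF len ij(2,1)] ij C Ac
      by (simp add: u_def list_of_vec_index)
  qed
  ultimately show ?thesis by (auto simp: extends_with_def)
qed

lemma solve_sylvester_correct: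
  assumes s: "length s = l" and A: "stores s n n a A" and F: "stores s n n f F"
    and S: "is_sylvester_solution n A A F S" and uniq: "\<exists>!S. is_sylvester_solution n A A F S"
  shows "extends_with B W s
    [Solve_Sylvester n (positions n n a) (positions n n a) (positions n n f)] (n * n)
    n n (row_major l n) S"
proof -
  have c: "A \<in> carrier_mat n n" "F \<in> carrier_mat n n" "S \<in> carrier_mat n n"
    using A F S by (auto simp: stores_def is_sylvester_solution_def)
  have "instr_step B W s
    (Solve_Sylvester n (positions n n a) (positions n n a) (positions n n f)) (entries S)"
    using c uniq S stores_read_at[OF A] stores_read_at[OF F]
    by (intro instr_step.intros(4)[where P = A and Q = A and F = F]) auto
  from run_single[where step = "instr_step B W", OF this] show ?thesis
    using stores_entries[OF c(3), of s "[]"] s c by (auto simp: extends_with_def length_entries)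
qed


section \<open>Costs\<close>

definition cost :: "nat \<Rightarrow> nat \<Rightarrow> (nat \<Rightarrow> nat) \<Rightarrow> instr list \<Rightarrow> nat" where
  "cost tB tM syl cs = sum_list (map (instr_cost tB tM syl) cs)"

lemma cost_append: "cost tB tM syl (cs @ cs') = cost tB tM syl cs + cost tB tM syl cs'"
  by (simp add: cost_def)

lemma cost_Cons: "cost tB tM syl (c # cs) = instr_cost tB tM syl c + cost tB tM syl cs"
  by (simp add: cost_def)

lemma cost_blocks:
  "(\<And>k. k < n \<Longrightarrow> cost tB tM syl (frag k) = w) \<Longrightarrow>
    cost tB tM syl (concat (map frag [0..<n])) = n * w"
  by (induction n) (auto simp: cost_def)

lemma cost_accumulate: "cost tB tM syl (accumulate a l ps) = 2 * length ps"
  by (induction a l ps rule: accumulate.induct) (auto simp: cost_def)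

lemma cost_product_prog: "cost tB tM syl (product_prog l m k n a b) = m * n * (2 * k)"
  unfolding product_prog_def
  by (rule cost_blocks)
    (use cost_accumulate in \<open>simp add: inner_product_prog_def cost_def\<close>)

lemma cost_entrywise_prog:
  "(\<And>i j. arith_cost (op i j) = 1) \<Longrightarrow> cost tB tM syl (entrywise_prog op m n a b) = m * n"
  unfolding entrywise_prog_def by (subst cost_blocks[where w = 1]) (auto simp: cost_def)

lemma cost_columns_prog:
  "(\<And>is. instr_cost tB tM syl (call is) = c) \<Longrightarrow> cost tB tM syl (columns_prog call m n a) = n * c"
  unfolding columns_prog_def by (intro cost_blocks) (auto simp: cost_def)

text \<open>The asymptotic bound fails at most for finitely many arguments; as \<open>n ^ 3\<close> is at least 1, adding
  the sum of the values there to the constant covers them too.\<close>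

lemma cubic_bound:
  fixes f :: "nat \<Rightarrow> nat"
  assumes "(\<lambda>n. real (f n)) \<in> O(\<lambda>n. real n ^ 3)"
  shows "\<exists>K \<ge> 0. \<forall>n \<ge> 1. real (f n) \<le> K * real n ^ 3"
proof -
  obtain c where c: "c > 0" "\<forall>\<^sub>F n in sequentially. norm (real (f n)) \<le> c * norm (real n ^ 3)"
    using assms by (rule landau_o.bigE)
  then obtain N where N: "\<And>n. n \<ge> N \<Longrightarrow> real (f n) \<le> c * real n ^ 3"
    by (auto simp: eventually_sequentially)
  define K where "K = c + (\<Sum>n<N. real (f n))"
  have K: "K \<ge> c" by (auto simp: K_def intro: sum_nonneg)
  have "real (f n) \<le> K * real n ^ 3" if n: "n \<ge> 1" for n
  proof (cases "n < N")
    case True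
    have "real (f n) \<le> (\<Sum>n<N. real (f n))"
      using True by (intro member_le_sum) auto
    then have "real (f n) \<le> K" using c by (simp add: K_def)
    also have "K * 1 \<le> K * real n ^ 3"
      using n K c by (intro mult_left_mono one_le_power) auto
    finally show ?thesis by simp
  next
    case False
    then have "real (f n) \<le> c * real n ^ 3" by (intro N) auto
    also have "\<dots> \<le> K * real n ^ 3" using K by (intro mult_right_mono) auto
    finally show ?thesis .
  qed
  then show ?thesis using K c by (intro exI[of _ K]) auto
qed


section \<open>The projection program\<close>

text \<open>The intermediate matrices, in the order in which they are computed, are \<open>Y = B X\<close>,
  \<open>U = M\<^sub>X\<^sup>-\<^sup>1 Y\<close>, \<open>A = Y\<^sup>T U\<close>, \<open>H = Y\<^sup>T \<xi>\<close>, \<open>F = H + H\<^sup>T\<close>, the solution \<open>S\<close>,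
  the product \<open>U S\<close> and finally \<open>\<xi> - U S\<close>. Computing \<open>X\<^sup>T B\<close> as \<open>Y\<^sup>T\<close> saves further calls
  for \<open>B\<close>. Each \<open>l\<close> is the length of the state before a step, and a lower-case letter gives
  the positions of the matrix with the corresponding capital letter, \<open>z\<close> those of \<open>\<xi>\<close> and \<open>v\<close>
  those of \<open>U S\<close>.\<close>

definition projection_prog :: "nat \<Rightarrow> nat \<Rightarrow> instr program" where
  "projection_prog d p =
    (let x = row_major 0 p; z = row_major (d * p) p;
         l0 = d * p + d * p;         y = col_major l0 d;
         l1 = l0 + p * d;            u = col_major l1 d;
         l2 = l1 + p * d;            a = product_position l2 d p;
         l3 = l2 + p * p * (2 * d + 1); h = product_position l3 d p;
         l4 = l3 + p * p * (2 * d + 1); f = row_major l4 p;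
         l5 = l4 + p * p;            s = row_major l5 p;
         l6 = l5 + p * p;            v = product_position l6 p p;
         l7 = l6 + d * p * (2 * p + 1)
     in (columns_prog Mult_B d p x @
         columns_prog Mult_Minv d p y @
         product_prog l2 p d p (\<lambda>i j. y j i) u @
         product_prog l3 p d p (\<lambda>i j. y j i) z @
         entrywise_prog Add p p h (\<lambda>i j. h j i) @
         [Solve_Sylvester p (positions p p a) (positions p p a) (positions p p f)] @
         product_prog l6 d p p u s @
         entrywise_prog Sub d p z v,
       positions d p (row_major l7 p)))"

lemma program_cost_projection_prog:
  "program_cost tB tM syl (projection_prog d p) =
     p * tB + p * tM + 2 * (p * p * (2 * d)) + p * p + syl p + d * p * (2 * p) + d * p"
  unfolding program_cost_def cost_def[symmetric] projection_prog_def Let_def fst_conv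
  by (simp add: cost_append cost_Cons cost_product_prog cost_entrywise_prog
      cost_columns_prog[where c = tB] cost_columns_prog[where c = tM])

text \<open>The constant is \<open>6\<close> for the three matrix products, \<open>1\<close> for each of the two entrywise operations,
  and \<open>K\<close> for the Sylvester equation; \<open>1 \<le> p \<le> d\<close> bounds \<open>p\<^sup>2\<close>, \<open>d p\<close> and \<open>p\<^sup>3\<close> by \<open>d p\<^sup>2\<close>.\<close>

lemma projection_prog_cost_bound:
  assumes p: "1 \<le> p" "p \<le> d" and K: "K \<ge> 0" "real (syl p) \<le> K * real p ^ 3"
  shows "real (program_cost tB tM syl (projection_prog d p)) \<le>
    (8 + K) * (real tB * real p + real tM * real p + real d * real p ^ 2)"
proof -
  have pp: "real p * real p \<le> real d * real p ^ 2"
    using p mult_right_mono[of 1 "real d" "real p ^ 2"] by (simp add: power2_eq_square)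
  have dp: "real d * real p \<le> real d * real p ^ 2"
    using p mult_left_mono[of 1 "real p" "real d * real p"] by (simp add: power2_eq_square mult_ac)
  have "real p ^ 3 \<le> real d * real p ^ 2"
    using p by (simp add: power3_eq_cube power2_eq_square mult_right_mono)
  then have "K * real p ^ 3 \<le> K * (real d * real p ^ 2)" by (intro mult_left_mono K)
  then have s: "real (syl p) \<le> K * (real d * real p ^ 2)" using K by linarith
  have t: "1 * (real tB * real p + real tM * real p) \<le> (8 + K) * (real tB * real p + real tM * real p)"
    using K by (intro mult_right_mono) auto
  have "real (program_cost tB tM syl (projection_prog d p)) =
    (real tB * real p + real tM * real p) + 6 * (real d * real p ^ 2) + real p * real p + real d * real p
      + real (syl p)"
    by (simp add: program_cost_projection_prog power2_eq_square algebra_simps)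
  also have "\<dots> \<le> (8 + K) * (real tB * real p + real tM * real p) + (8 + K) * (real d * real p ^ 2)"
    using pp dp s t by (simp add: distrib_right)
  finally show ?thesis by (simp add: distrib_left)
qed

context stiefel_point
begin

lemma projection_prog_correct:
  assumes \<xi>: "\<xi> \<in> carrier_mat d p"
    and S: "is_sylvester_solution p A A
      (transpose_mat X * B * \<xi> + transpose_mat (transpose_mat X * B * \<xi>)) S"
  shows "computes (instr_step B W) (projection_prog d p) (entries X @ entries \<xi>)
    (entries (\<xi> - W * B * X * S))"
proof -
  note c = carriers \<xi> S_carrier[OF \<xi> S]
  define Y where "Y = B * X"
  define U where "U = W * Y"
  define H where "H = transpose_mat Y * \<xi>"
  define F where "F = H + transpose_mat H"
  have cY: "Y \<in> carrier_mat d p" and cU: "U \<in> carrier_mat d p"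
    and cH: "H \<in> carrier_mat p p" and cF: "F \<in> carrier_mat p p"
    using c by (auto simp: Y_def U_def H_def F_def simp del: assoc_mult_mat)
  have U: "U = W * B * X"
    unfolding U_def Y_def using c by (intro assoc_mult_mat[symmetric]) auto
  have H: "transpose_mat X * B * \<xi> = H"
    by (simp only: H_def Y_def transpose_BX)
  have A: "A = transpose_mat Y * U"
    unfolding A_eq U_def Y_def using c
    by (intro assoc_mult_mat[of _ p d _ d _ p]) auto
  have S': "is_sylvester_solution p (transpose_mat Y * U) (transpose_mat Y * U) F S"
    using S by (simp only: A H F_def)
  have uniq: "\<exists>!S. is_sylvester_solution p (transpose_mat Y * U) (transpose_mat Y * U) F S"
    using sylvester_solvable[OF \<xi>] by (simp only: A H F_def)

  define x where "x = row_major 0 p"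
  define z where "z = row_major (d * p) p"
  define l0 where "l0 = d * p + d * p"
  define y where "y = col_major l0 d"
  define l1 where "l1 = l0 + p * d"
  define u where "u = col_major l1 d"
  define l2 where "l2 = l1 + p * d"
  define a where "a = product_position l2 d p"
  define l3 where "l3 = l2 + p * p * (2 * d + 1)"
  define h where "h = product_position l3 d p"
  define l4 where "l4 = l3 + p * p * (2 * d + 1)"
  define f where "f = row_major l4 p"
  define l5 where "l5 = l4 + p * p"
  define s where "s = row_major l5 p"
  define l6 where "l6 = l5 + p * p"
  define v where "v = product_position l6 p p"
  define l7 where "l7 = l6 + d * p * (2 * p + 1)"
  note defs = x_def z_def l0_def y_def l1_def u_def l2_def a_def l3_def h_def l4_def f_def
    l5_def s_def l6_def v_def l7_def
  let ?run = "run (instr_step B W)"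

  define s0 where "s0 = entries X @ entries \<xi>"
  have l0: "length s0 = l0" using c by (simp add: s0_def l0_def length_entries)
  have x0: "stores s0 d p x X" and z0: "stores s0 d p z \<xi>"
    using stores_entries[OF c(1), of "[]" "entries \<xi>"] stores_entries[OF \<xi>, of "entries X" "[]"] c
    by (auto simp: s0_def x_def z_def length_entries)

  have "extends_with B W s0 (columns_prog Mult_B d p x) (p * d) d p y Y"
    unfolding y_def Y_def using c
    by (intro columns_prog_correct[OF _ _ l0 x0]) (auto intro: instr_step.intros)
  then obtain t1 where r1: "?run s0 (columns_prog Mult_B d p x) (s0 @ t1)"
    and "length t1 = p * d" and y1: "stores (s0 @ t1) d p y Y"
    by (auto simp: extends_with_def)
  define s1 where "s1 = s0 @ t1"
  have l1: "length s1 = l1" using l0 \<open>length t1 = _\<close> by (simp add: s1_def l1_def)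
  note 1 = r1[folded s1_def] y1[folded s1_def] stores_append[OF z0, of t1, folded s1_def]

  have "extends_with B W s1 (columns_prog Mult_Minv d p y) (p * d) d p u U"
    unfolding u_def U_def using c
    by (intro columns_prog_correct[OF _ _ l1 1(2)]) (auto intro: instr_step.intros)
  then obtain t2 where r2: "?run s1 (columns_prog Mult_Minv d p y) (s1 @ t2)"
    and "length t2 = p * d" and u2: "stores (s1 @ t2) d p u U"
    by (auto simp: extends_with_def)
  define s2 where "s2 = s1 @ t2"
  have l2: "length s2 = l2" using l1 \<open>length t2 = _\<close> by (simp add: s2_def l2_def)
  note 2 = r2[folded s2_def] u2[folded s2_def] 1(2,3)[THEN stores_append, of t2, folded s2_def]

  have "extends_with B W s2 (product_prog l2 p d p (\<lambda>i j. y j i) u) (p * p * (2 * d + 1))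
      p p a (transpose_mat Y * U)"
    unfolding a_def by (rule product_prog_correct[OF l2 stores_transpose[OF 2(3)] 2(2)])
  then obtain t3 where r3: "?run s2 (product_prog l2 p d p (\<lambda>i j. y j i) u) (s2 @ t3)"
    and "length t3 = p * p * (2 * d + 1)" and a3: "stores (s2 @ t3) p p a (transpose_mat Y * U)"
    by (auto simp: extends_with_def)
  define s3 where "s3 = s2 @ t3"
  have l3: "length s3 = l3" using l2 \<open>length t3 = _\<close> by (simp add: s3_def l3_def)
  note 3 = r3[folded s3_def] a3[folded s3_def] 2(2-4)[THEN stores_append, of t3, folded s3_def]

  have "extends_with B W s3 (product_prog l3 p d p (\<lambda>i j. y j i) z) (p * p * (2 * d + 1)) p p h H"
    unfolding h_def H_def by (rule product_prog_correct[OF l3 stores_transpose[OF 3(4)] 3(5)])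
  then obtain t4 where r4: "?run s3 (product_prog l3 p d p (\<lambda>i j. y j i) z) (s3 @ t4)"
    and "length t4 = p * p * (2 * d + 1)" and h4: "stores (s3 @ t4) p p h H"
    by (auto simp: extends_with_def)
  define s4 where "s4 = s3 @ t4"
  have l4: "length s4 = l4" using l3 \<open>length t4 = _\<close> by (simp add: s4_def l4_def)
  note 4 = r4[folded s4_def] h4[folded s4_def] 3(2,3,5)[THEN stores_append, of t4, folded s4_def]

  have "extends_with B W s4 (entrywise_prog Add p p h (\<lambda>i j. h j i)) (p * p) p p f F"
    unfolding f_def
    by (rule entrywise_prog_correct[OF _ l4 4(2) stores_transpose[OF 4(2)] cF, of _ "(+)"])
      (use cH in \<open>auto simp: F_def read_at_def intro: arith_step.intros\<close>)
  then obtain t5 where r5: "?run s4 (entrywise_prog Add p p h (\<lambda>i j. h j i)) (s4 @ t5)"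
    and "length t5 = p * p" and f5: "stores (s4 @ t5) p p f F"
    by (auto simp: extends_with_def)
  define s5 where "s5 = s4 @ t5"
  have l5: "length s5 = l5" using l4 \<open>length t5 = _\<close> by (simp add: s5_def l5_def)
  note 5 = r5[folded s5_def] f5[folded s5_def] 4(3-5)[THEN stores_append, of t5, folded s5_def]

  let ?solve = "[Solve_Sylvester p (positions p p a) (positions p p a) (positions p p f)]"
  have "extends_with B W s5 ?solve (p * p) p p s S"
    unfolding s_def by (rule solve_sylvester_correct[OF l5 5(3,2) S' uniq])
  then obtain t6 where r6: "?run s5 ?solve (s5 @ t6)"
    and "length t6 = p * p" and s6: "stores (s5 @ t6) p p s S"
    by (auto simp: extends_with_def)
  define s6 where "s6 = s5 @ t6"
  have l6: "length s6 = l6" using l5 \<open>length t6 = _\<close> by (simp add: s6_def l6_def)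
  note 6 = r6[folded s6_def] s6[folded s6_def] 5(4,5)[THEN stores_append, of t6, folded s6_def]

  have "extends_with B W s6 (product_prog l6 d p p u s) (d * p * (2 * p + 1)) d p v (U * S)"
    unfolding v_def by (rule product_prog_correct[OF l6 6(3,2)])
  then obtain t7 where r7: "?run s6 (product_prog l6 d p p u s) (s6 @ t7)"
    and "length t7 = d * p * (2 * p + 1)" and v7: "stores (s6 @ t7) d p v (U * S)"
    by (auto simp: extends_with_def)
  define s7 where "s7 = s6 @ t7"
  have l7: "length s7 = l7" using l6 \<open>length t7 = _\<close> by (simp add: s7_def l7_def)
  note 7 = r7[folded s7_def] v7[folded s7_def] 6(4)[THEN stores_append, of t7, folded s7_def]

  have "extends_with B W s7 (entrywise_prog Sub d p z v) (d * p) d p (row_major l7 p) (\<xi> - U * S)"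
    by (rule entrywise_prog_correct[OF _ l7 7(3,2), of _ "(-)"])
      (use cU c(5,6) in \<open>auto simp: read_at_def minus_carrier_mat intro: arith_step.intros\<close>)
  then obtain s8 where r8: "?run s7 (entrywise_prog Sub d p z v) s8"
    and 8: "stores s8 d p (row_major l7 p) (\<xi> - U * S)"
    by (auto simp: extends_with_def)

  have "?run s0 (fst (projection_prog d p)) s8"
    unfolding projection_prog_def Let_def fst_conv defs[symmetric]
    by (intro run_append[OF 1(1)] run_append[OF 2(1)] run_append[OF 3(1)] run_append[OF 4(1)]
        run_append[OF 5(1)] run_append[OF 6(1)] run_append[OF 7(1)] r8)
  moreover have "snd (projection_prog d p) = positions d p (row_major l7 p)"
    unfolding projection_prog_def Let_def snd_conv defs[symmetric] ..
  ultimately show ?thesis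
    using stores_read_at[OF 8] by (auto simp: computes_def s0_def U)
qed

end


lemma stiefel_pointI:
  "stiefel_setting d p B M \<Longrightarrow> X \<in> stiefel d p B \<Longrightarrow> stiefel_point d p B M X"
  by unfold_locales (auto simp: stiefel_setting_def stiefel_def)

theorem lemma3p1:
  fixes syl :: "nat \<Rightarrow> nat"
  assumes sylvester_cost: "(\<lambda>n. real (syl n)) \<in> O(\<lambda>n. real n ^ 3)"
  shows
    "(\<forall>d p B M. stiefel_setting d p B M \<longrightarrow>
        (\<forall>X \<in> stiefel d p B. \<forall>\<xi> \<in> carrier_mat d p.
          let W = mat_inv (M X);
              A = transpose_mat X * B * W * B * X;
              F = transpose_mat X * B * \<xi> + transpose_mat (transpose_mat X * B * \<xi>);
              g = metric (M X);
              T = tangent_space d p B X;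
              N = normal_space d p B M X
          in (\<exists>!S. is_sylvester_solution p A A F S) \<and>
             (\<exists>!\<eta>. is_orth_proj g N \<xi> \<eta>) \<and>
             (\<exists>!\<eta>. is_orth_proj g T \<xi> \<eta>) \<and>
             (\<forall>S. is_sylvester_solution p A A F S \<longrightarrow>
                orth_proj g N \<xi> = W * B * X * S \<and>
                orth_proj g T \<xi> = \<xi> - orth_proj g N \<xi> \<and>
                orth_proj g T \<xi> = \<xi> - W * B * X * S)))
     \<and>
     (\<exists>C::real. \<forall>d p. 1 \<le> p \<and> p \<le> d \<longrightarrow>
        (\<exists>P :: instr program. \<forall>B M RB RM.
           stiefel_setting d p B M \<and>
           matvec_routine d B RB \<and>
           (\<forall>X \<in> stiefel d p B. matvec_routine d (mat_inv (M X)) (RM X)) \<and>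
           bdd_above ((\<lambda>X. routine_cost (RM X)) ` stiefel d p B) \<longrightarrow>
           (let T_B = routine_cost RB;
                T_Minv = (SUP X \<in> stiefel d p B. routine_cost (RM X))
            in \<forall>X \<in> stiefel d p B.
                 (\<forall>\<xi> \<in> carrier_mat d p.
                    computes (instr_step B (mat_inv (M X))) P (entries X @ entries \<xi>)
                      (entries (orth_proj (metric (M X)) (tangent_space d p B X) \<xi>))) \<and>
                 real (program_cost T_B (routine_cost (RM X)) syl P)
                   \<le> C * (real T_B * real p + real T_Minv * real p + real d * real p ^ 2))))"
proof (intro conjI allI impI ballI)
  fix d p B M and X \<xi> :: "real mat"
  assume "stiefel_setting d p B M" "X \<in> stiefel d p B" and \<xi>: "\<xi> \<in> carrier_mat d p"
  then interpret stiefel_point d p B M X by (intro stiefel_pointI)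
  note ex1 = sylvester_solvable[OF \<xi>]
  then obtain S where S: "is_sylvester_solution p A A
      (transpose_mat X * B * \<xi> + transpose_mat (transpose_mat X * B * \<xi>)) S" by blast
  show "let W = mat_inv (M X);
              A = transpose_mat X * B * W * B * X;
              F = transpose_mat X * B * \<xi> + transpose_mat (transpose_mat X * B * \<xi>);
              g = metric (M X);
              T = tangent_space d p B X;
              N = normal_space d p B M X
          in (\<exists>!S. is_sylvester_solution p A A F S) \<and>
             (\<exists>!\<eta>. is_orth_proj g N \<xi> \<eta>) \<and>
             (\<exists>!\<eta>. is_orth_proj g T \<xi> \<eta>) \<and>
             (\<forall>S. is_sylvester_solution p A A F S \<longrightarrow>
                orth_proj g N \<xi> = W * B * X * S \<and>
                orth_proj g T \<xi> = \<xi> - orth_proj g N \<xi> \<and>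
                orth_proj g T \<xi> = \<xi> - W * B * X * S)"
    unfolding Let_def
  proof (intro conjI allI impI)
    show "\<exists>!\<eta>. is_orth_proj (metric (M X)) (normal_space d p B M X) \<xi> \<eta>"
      by (rule orth_proj_normal(1)[OF \<xi> S normal_space_carrier])
    show "\<exists>!\<eta>. is_orth_proj (metric (M X)) (tangent_space d p B X) \<xi> \<eta>"
      by (rule orth_proj_tangent(1)[OF \<xi> S tangent_space_carrier])
  next
    fix S assume S: "is_sylvester_solution p A A
      (transpose_mat X * B * \<xi> + transpose_mat (transpose_mat X * B * \<xi>)) S"
    show N: "orth_proj (metric (M X)) (normal_space d p B M X) \<xi> = W * B * X * S"
      by (rule orth_proj_normal(2)[OF \<xi> S normal_space_carrier])
    show T: "orth_proj (metric (M X)) (tangent_space d p B X) \<xi> = \<xi> - W * B * X * S"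
      by (rule orth_proj_tangent(2)[OF \<xi> S tangent_space_carrier])
    show "orth_proj (metric (M X)) (tangent_space d p B X) \<xi> =
        \<xi> - orth_proj (metric (M X)) (normal_space d p B M X) \<xi>"
      unfolding N T ..
  qed (rule ex1)
next
  obtain K where K: "K \<ge> 0" "\<And>n. n \<ge> 1 \<Longrightarrow> real (syl n) \<le> K * real n ^ 3"
    using cubic_bound[OF sylvester_cost] by blast
  show "\<exists>C::real. \<forall>d p. 1 \<le> p \<and> p \<le> d \<longrightarrow>
        (\<exists>P :: instr program. \<forall>B M RB RM.
           stiefel_setting d p B M \<and>
           matvec_routine d B RB \<and>
           (\<forall>X \<in> stiefel d p B. matvec_routine d (mat_inv (M X)) (RM X)) \<and>
           bdd_above ((\<lambda>X. routine_cost (RM X)) ` stiefel d p B) \<longrightarrow>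
           (let T_B = routine_cost RB;
                T_Minv = (SUP X \<in> stiefel d p B. routine_cost (RM X))
            in \<forall>X \<in> stiefel d p B.
                 (\<forall>\<xi> \<in> carrier_mat d p.
                    computes (instr_step B (mat_inv (M X))) P (entries X @ entries \<xi>)
                      (entries (orth_proj (metric (M X)) (tangent_space d p B X) \<xi>))) \<and>
                 real (program_cost T_B (routine_cost (RM X)) syl P)
                   \<le> C * (real T_B * real p + real T_Minv * real p + real d * real p ^ 2)))"
    unfolding Let_def
  proof (rule exI[of _ "8 + K"], intro allI impI exI[of _ "projection_prog _ _"] ballI conjI; (elim conjE)?)
    fix d p B M and X \<xi> :: "real mat"
    assume "stiefel_setting d p B M" "X \<in> stiefel d p B" and \<xi>: "\<xi> \<in> carrier_mat d p"
    then interpret stiefel_point d p B M X by (intro stiefel_pointI)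
    obtain S where S: "is_sylvester_solution p A A
        (transpose_mat X * B * \<xi> + transpose_mat (transpose_mat X * B * \<xi>)) S"
      using sylvester_solvable[OF \<xi>] by blast
    show "computes (instr_step B W) (projection_prog d p) (entries X @ entries \<xi>)
        (entries (orth_proj (metric (M X)) (tangent_space d p B X) \<xi>))"
      unfolding orth_proj_tangent(2)[OF \<xi> S tangent_space_carrier]
      by (rule projection_prog_correct[OF \<xi> S])
  next
    fix d p B X and RB :: "arith program" and RM :: "real mat \<Rightarrow> arith program"
    assume p: "1 \<le> p" "p \<le> d" and X: "X \<in> stiefel d p B"
      and bdd: "bdd_above ((\<lambda>X. routine_cost (RM X)) ` stiefel d p B)"
    let ?tB = "routine_cost RB" and ?tM = "SUP X \<in> stiefel d p B. routine_cost (RM X)"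
    have "real (program_cost ?tB (routine_cost (RM X)) syl (projection_prog d p))
        \<le> (8 + K) * (real ?tB * real p + real (routine_cost (RM X)) * real p + real d * real p ^ 2)"
      by (intro projection_prog_cost_bound p K)
    also have "routine_cost (RM X) \<le> ?tM" by (rule cSUP_upper[OF X bdd])
    then have "(8 + K) * (real ?tB * real p + real (routine_cost (RM X)) * real p + real d * real p ^ 2)
        \<le> (8 + K) * (real ?tB * real p + real ?tM * real p + real d * real p ^ 2)"
      using K(1) by (intro mult_left_mono add_mono mult_right_mono) auto
    finally show "real (program_cost ?tB (routine_cost (RM X)) syl (projection_prog d p))
        \<le> (8 + K) * (real ?tB * real p + real ?tM * real p + real d * real p ^ 2)" .
  qed
qed

end
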